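(* Let $\mathbb{K}$ be an infinite field, $R=\mathbb{K}[X_1,\dots,X_n]$ with its standard $\mathbb{Z}^n$-grading, and $M$ a finitely generated $\mathbb{N}^n$-graded $R$-module which is positively $\mathbf{g}$-determined for some $\mathbf{g}\in\mathbb{N}^n$. Let $\Omega=\{(\mathbb{K}[Z],\mathbf{a}) : \mathbf{a}\in\mathbb{N}^n,\ \mathbf{a}\preceq\mathbf{g},\ Z\subseteq[n],\ \{j : g_j=a_j\}\subseteq Z\}$. A vector $u\in\mathbb{N}^\Omega$ corresponds to a $\mathbf{g}$-determined Hilbert decomposition of $M$ which is induced by a $\mathbf{g}$-determined Stanley decomposition of $M$ if and only if it satisfies both $$\sum_{\mathbf{b}\in[\mathbf{0},\mathbf{a}]}\ \sum_{\substack{Z\subseteq[n]\\ \operatorname{supp}(\mathbf{a}-\mathbf{b})\subseteq Z}}u(\mathbf{b},Z)=\dim_{\mathbb{K}}M_{\mathbf{a}}\qquad\text{for all }\mathbf{a}\in[\mathbf{0},\mathbf{g}]$$ and $$\sum_{\mathbf{b}\in J}\ \sum_{\substack{Z\subseteq[n]\\ \operatorname{supp}(\mathbf{a}-\mathbf{b})\subseteq Z}}u(\mathbf{b},Z)\le\dim_{\mathbb{K}}\sum_{\mathbf{b}\in J}\mathbf{X}^{\mathbf{a}-\mathbf{b}}M_{\mathbf{b}}\qquad\text{for all }\mathbf{a}\in[\mathbf{0},\mathbf{g}]\text{ and all }J\subseteq[\mathbf{0},\mathbf{a}],$$ where the sum on the right-hand side of the second condition is a sum of vector subspaces of $M_{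\mathbf{a}}$.
   Context: Notation: $[n]=\{1,\dots,n\}$; $\preceq$ is the componentwise order on $\mathbb{Z}^n$; $[\mathbf{a},\mathbf{b}]=\{\mathbf{c}\in\mathbb{Z}^n : \mathbf{a}\preceq\mathbf{c}\preceq\mathbf{b}\}$; $\mathbf{e}_k$ is the $k$-th unit vector; $\mathbf{X}^{\mathbf{a}}=X_1^{a_1}\cdots X_n^{a_n}$; $\operatorname{supp}(\mathbf{a})=\{i\in[n] : a_i\ne 0\}$; for $Z\subseteq[n]$, $\mathbb{K}[Z]=\mathbb{K}[X_j : j\in Z]$; $\mathbb{N}$ contains $0$. Positively $\mathbf{g}$-determined: $M_{\mathbf{a}}=0$ for $\mathbf{a}\notin\mathbb{N}^n$, and multiplication by $X_k$, $M_{\mathbf{a}}\to M_{\mathbf{a}+\mathbf{e}_k}$, is an isomorphism whenever $a_k\ge g_k$. Hilbert decomposition of $M$: a finite family $(\mathbb{K}[Z_i],\mathbf{s}_i)_{i\in I}$ with $\mathbf{s}_i\in\mathbb{Z}^n$, $Z_i\subseteq[n]$, such that $M\cong\bigoplus_{i\in I}\mathbb{K}[Z_i](-\mathbf{s}_i)$ as multigraded $\mathbb{K}$-vector spaces. For $M$ positively $\mathbf{g}$-determined, it is $\mathbf{g}$-determined if $\mathbf{s}_i\preceq\mathbf{g}$ for all $i$ (equivalently, $\{j : (\mathbf{s}_i)_j=g_j\}\subseteq Z_i$ for all $i$). Stanley decomposition of $M$: a finite family $(\mathbb{K}[Z_i],m_i)_{i\in I}$ with $m_i\in M$ homogeneous,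 $\mathbb{K}[Z_i]\cap\operatorname{Ann}m_i=0$ for each $i$, and $M=\bigoplus_{i\in I}m_i\mathbb{K}[Z_i]$ as a multigraded $\mathbb{K}$-vector space. It induces the Hilbert decomposition $(\mathbb{K}[Z_i],\deg m_i)_{i\in I}$, and it is called $\mathbf{g}$-determined if this Hilbert decomposition is $\mathbf{g}$-determined. $\mathbb{N}^\Omega$ is the free commutative monoid with generators $\mathbf{e}_\omega$, $\omega\in\Omega$. A $\mathbf{g}$-determined Hilbert decomposition $(R_i,\mathbf{s}_i)_{i\in I}$ corresponds to (is identified with) the element $\sum_{i\in I}\mathbf{e}_{(R_i,\mathbf{s}_i)}\in\mathbb{N}^\Omega$. For $u\in\mathbb{N}^\Omega$, $u(\mathbf{b},Z)$ denotes the component of $u$ at $(\mathbb{K}[Z],\mathbf{b})\in\Omega$; for pairs with $(\mathbb{K}[Z],\mathbf{b})\notin\Omega$ set $u(\mathbf{b},Z)=0$. *)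

theory Defs
  imports "HOL-Analysis.Finite_Cartesian_Product" "HOL-Library.Poly_Mapping"
begin

text \<open>
  The variables are indexed by a finite type \<open>'n\<close>, so \<open>\<int>\<^sup>n\<close> is \<open>int ^ 'n\<close> with its library
  (componentwise) order, and the polynomial ring is the monoid algebra of \<open>\<nat>\<^sup>n\<close>: a polynomial maps
  exponent vectors to coefficients, with finite support.
\<close>

type_synonym ('k, 'n) mpol = "(nat ^ 'n) \<Rightarrow>\<^sub>0 'k"

definition int_vec :: "nat ^ 'n \<Rightarrow> int ^ 'n" where
  "int_vec t = (\<chi> i. int (t $ i))"

text \<open>Truncating; only used on vectors in \<open>\<nat>\<^sup>n\<close>.\<close>

definition nat_vec :: "int ^ 'n \<Rightarrow> nat ^ 'n" where
  "nat_vec a = (\<chi> i. nat (a $ i))"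

definition supp :: "int ^ 'n \<Rightarrow> 'n set" where
  "supp a = {i. a $ i \<noteq> 0}"

definition const_poly :: "'k::field \<Rightarrow> ('k, 'n::finite) mpol" where
  "const_poly c = Poly_Mapping.single 0 c"

definition X_pow :: "int ^ 'n \<Rightarrow> ('k::field, 'n::finite) mpol" where
  "X_pow a = Poly_Mapping.single (nat_vec a) 1"

definition X_var :: "'n \<Rightarrow> ('k::field, 'n::finite) mpol" where
  "X_var k = X_pow (axis k 1)"

definition polys_in :: "'n set \<Rightarrow> ('k::field, 'n::finite) mpol set" where
  "polys_in Z = {p. \<forall>t \<in> Poly_Mapping.keys p. \<forall>j. t $ j \<noteq> 0 \<longrightarrow> j \<in> Z}"

definition is_direct_sum :: "'i set \<Rightarrow> ('i \<Rightarrow> 'm::ab_group_add set) \<Rightarrow> bool" where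
  "is_direct_sum I V \<longleftrightarrow>
     (\<forall>x. \<exists>!v :: 'i \<Rightarrow>\<^sub>0 'm. Poly_Mapping.keys v \<subseteq> I \<and>
        (\<forall>i \<in> I. Poly_Mapping.lookup v i \<in> V i) \<and>
        (\<Sum>i \<in> Poly_Mapping.keys v. Poly_Mapping.lookup v i) = x)"

text \<open>
  The module is the whole type \<open>'m\<close>, and \<open>M a\<close> is its homogeneous component of degree \<open>a\<close>.
  Multiplication by all terms \<open>c X\<^sup>t\<close> includes the scalars (\<open>t = 0\<close>), so every \<open>M a\<close> is a subspace.
\<close>

locale multigraded_module = module smul
  for smul :: "('k::field, 'n::finite) mpol \<Rightarrow> 'm::ab_group_add \<Rightarrow> 'm" +
  fixes M :: "int ^ 'n \<Rightarrow> 'm set"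
  assumes zero_mem: "0 \<in> M a"
    and add_mem: "x \<in> M a \<Longrightarrow> y \<in> M a \<Longrightarrow> x + y \<in> M a"
    and smul_mem: "x \<in> M a \<Longrightarrow> smul (Poly_Mapping.single t c) x \<in> M (a + int_vec t)"
    and direct_sum: "is_direct_sum UNIV M"

definition finitely_generated ::
  "(('k::field, 'n::finite) mpol \<Rightarrow> 'm::ab_group_add \<Rightarrow> 'm) \<Rightarrow> bool" where
  "finitely_generated smul \<longleftrightarrow> (\<exists>S. finite S \<and> module.span smul S = UNIV)"

text \<open>Multiplication by a variable is linear, so it is an isomorphism iff it is bijective.\<close>

definition positively_determined ::
  "(('k::field, 'n::finite) mpol \<Rightarrow> 'm::ab_group_add \<Rightarrow> 'm) \<Rightarrow> (int ^ 'n \<Rightarrow> 'm set)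
     \<Rightarrow> int ^ 'n \<Rightarrow> bool" where
  "positively_determined smul M g \<longleftrightarrow>
     (\<forall>a. \<not> 0 \<le> a \<longrightarrow> M a = {0}) \<and>
     (\<forall>a k. g $ k \<le> a $ k \<longrightarrow> bij_betw (smul (X_var k)) (M a) (M (a + axis k 1)))"

definition dim_K ::
  "(('k::field, 'n::finite) mpol \<Rightarrow> 'm::ab_group_add \<Rightarrow> 'm) \<Rightarrow> 'm set \<Rightarrow> nat" where
  "dim_K smul V = vector_space.dim (\<lambda>c. smul (const_poly c)) V"

text \<open>
  The external direct sum of the \<open>K[Z\<^sub>i](-s\<^sub>i)\<close>, \<open>i \<in> I\<close> (with \<open>I\<close> finite), as families of
  polynomials, and its component of degree \<open>a\<close>.
\<close>

definition ext_sum :: "'i set \<Rightarrow> ('i \<Rightarrow> 'n set) \<Rightarrow> ('i \<Rightarrow> ('k::field, 'n::finite) mpol) set" where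
  "ext_sum I Z = {f. (\<forall>i \<in> I. f i \<in> polys_in (Z i)) \<and> (\<forall>i. i \<notin> I \<longrightarrow> f i = 0)}"

definition ext_sum_comp :: "'i set \<Rightarrow> ('i \<Rightarrow> 'n set) \<Rightarrow> ('i \<Rightarrow> int ^ 'n) \<Rightarrow> int ^ 'n
     \<Rightarrow> ('i \<Rightarrow> ('k::field, 'n::finite) mpol) set" where
  "ext_sum_comp I Z s a =
     {f \<in> ext_sum I Z. \<forall>i \<in> I. \<forall>t \<in> Poly_Mapping.keys (f i). int_vec t = a - s i}"

definition hilbert_decomposition ::
  "(('k::field, 'n::finite) mpol \<Rightarrow> 'm::ab_group_add \<Rightarrow> 'm) \<Rightarrow> (int ^ 'n \<Rightarrow> 'm set)
     \<Rightarrow> 'i set \<Rightarrow> ('i \<Rightarrow> 'n set) \<Rightarrow> ('i \<Rightarrow> int ^ 'n) \<Rightarrow> bool" where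
  "hilbert_decomposition smul M I Z s \<longleftrightarrow> finite I \<and>
     (\<exists>\<phi> :: ('i \<Rightarrow> ('k, 'n) mpol) \<Rightarrow> 'm.
        bij_betw \<phi> (ext_sum I Z) UNIV \<and>
        (\<forall>f \<in> ext_sum I Z. \<forall>h \<in> ext_sum I Z. \<phi> (\<lambda>i. f i + h i) = \<phi> f + \<phi> h) \<and>
        (\<forall>c. \<forall>f \<in> ext_sum I Z. \<phi> (\<lambda>i. const_poly c * f i) = smul (const_poly c) (\<phi> f)) \<and>
        (\<forall>a. \<phi> ` ext_sum_comp I Z s a = M a))"

definition determined :: "int ^ 'n \<Rightarrow> 'i set \<Rightarrow> ('i \<Rightarrow> int ^ 'n) \<Rightarrow> bool" where
  "determined g I s \<longleftrightarrow> (\<forall>i \<in> I. s i \<le> g)"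

text \<open>
  The grading of the direct sum below need not be mentioned: its summands are spanned by the
  homogeneous elements \<open>X\<^sup>t m\<^sub>i\<close>, so the decomposition is automatically one of multigraded spaces.
\<close>

definition stanley_decomposition ::
  "(('k::field, 'n::finite) mpol \<Rightarrow> 'm::ab_group_add \<Rightarrow> 'm) \<Rightarrow> (int ^ 'n \<Rightarrow> 'm set)
     \<Rightarrow> 'i set \<Rightarrow> ('i \<Rightarrow> 'n set) \<Rightarrow> ('i \<Rightarrow> 'm) \<Rightarrow> bool" where
  "stanley_decomposition smul M I Z m \<longleftrightarrow> finite I \<and>
     (\<forall>i \<in> I. \<exists>a. m i \<in> M a) \<and>
     (\<forall>i \<in> I. polys_in (Z i) \<inter> {p. smul p (m i) = 0} = {0}) \<and>
     is_direct_sum I (\<lambda>i. (\<lambda>p. smul p (m i)) ` polys_in (Z i))"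

text \<open>
  Meaningful for nonzero homogeneous elements; the \<open>m\<^sub>i\<close> of a Stanley decomposition are nonzero
  because \<open>1 \<in> K[Z\<^sub>i]\<close> does not annihilate \<open>m\<^sub>i\<close>.
\<close>

definition hdeg :: "(int ^ 'n \<Rightarrow> 'm set) \<Rightarrow> 'm \<Rightarrow> int ^ 'n" where
  "hdeg M x = (THE a. x \<in> M a)"

text \<open>A pair \<open>(K[Z], a)\<close> is represented by \<open>(Z, a)\<close>; note that \<open>Z\<close> is determined by \<open>K[Z]\<close>.\<close>

definition Omega :: "int ^ 'n \<Rightarrow> ('n set \<times> (int ^ 'n)) set" where
  "Omega g = {(Z, a). 0 \<le> a \<and> a \<le> g \<and> {j. g $ j = a $ j} \<subseteq> Z}"

text \<open>
  \<open>\<nat>\<^sup>\<Omega>\<close> consists of the finitely supported functions vanishing off \<open>\<Omega>\<close>; the generator \<open>e\<^sub>\<omega>\<close> is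
  \<open>single \<omega> 1\<close>.
\<close>

definition free_comm_monoid :: "'w set \<Rightarrow> ('w \<Rightarrow>\<^sub>0 nat) set" where
  "free_comm_monoid W = {u. Poly_Mapping.keys u \<subseteq> W}"

definition decomposition_vector ::
  "'i set \<Rightarrow> ('i \<Rightarrow> 'n set) \<Rightarrow> ('i \<Rightarrow> int ^ 'n) \<Rightarrow> ('n set \<times> (int ^ 'n)) \<Rightarrow>\<^sub>0 nat" where
  "decomposition_vector I Z s = (\<Sum>i \<in> I. Poly_Mapping.single (Z i, s i) 1)"

definition subspace_sum ::
  "(('k::field, 'n::finite) mpol \<Rightarrow> 'm::ab_group_add \<Rightarrow> 'm) \<Rightarrow> (int ^ 'n \<Rightarrow> 'm set)
     \<Rightarrow> (int ^ 'n) set \<Rightarrow> int ^ 'n \<Rightarrow> 'm set" where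
  "subspace_sum smul M J a =
     {(\<Sum>b \<in> J. smul (X_pow (a - b)) (x b)) | x. \<forall>b \<in> J. x b \<in> M b}"

end

theory Submission
  imports Defs
begin

text \<open>
  In degree \<open>a\<close>, a Stanley decomposition \<open>(Z i, m i)\<close> with \<open>deg (m i) = s i\<close> provides the basis
  \<open>X\<^bsup>a - s i\<^esup> m i\<close> of \<open>M a\<close>, where \<open>i\<close> ranges over the indices active in degree \<open>a\<close>. Counting these basis
  elements, and those with \<open>s i \<in> J\<close>, gives both conditions. Conversely, the second condition is
  Rado's condition for choosing, in each degree \<open>a \<le> g\<close>, linearly independent vectors out of the
  spaces \<open>X\<^bsup>a - s i\<^esup> M (s i)\<close>. Over an infinite field generic elements \<open>m i \<in> M (s i)\<close> do this in all these
  degrees at once, the first condition turns independent families into bases, and multiplication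
  by the variables carries the bases to the degrees beyond \<open>g\<close>.
\<close>

subsection \<open>Linear algebra over an infinite field\<close>

text \<open>One and the same \<open>m i\<close> has to serve every degree in which \<open>i\<close>
  is active, so transversals found degree by degree would not fit together. The choice is therefore
  made index by index, and each choice must keep Rado's inequalities alive in every degree of the
  finite box \<open>{0..g}\<close> at once. An inequality is endangered only on a subspace that does
  not contain the whole space of candidates; there are finitely many of these, and an infinite field
  leaves a candidate outside all of them. Rado's inequalities range over sets of indices, the second
  condition only over sets \<open>J\<close> of degrees. This suffices because, in a fixed degree
  \<open>a\<close>, the space attached to an index depends on its degree \<open>s i\<close> alone.
  Both kinds of decomposition are handled through one map, \<open>gen_map\<close>, which sends a
  family of polynomials \<open>f i\<close> to the sum of the products of \<open>f i\<close> with
  \<open>m i\<close>. A Stanley decomposition amounts to its bijectivity, and bijectivity can be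
  tested in each degree separately, where it says that a family of vectors is a basis.\<close>

context vector_space
begin

text \<open>A vector space over an infinite field is not a finite union of proper subspaces. If
  \<open>w\<close> avoids all of \<open>C\<close> but lies in the new \<open>U\<close>, the line
  \<open>v + c w\<close> with \<open>v\<close> outside \<open>U\<close> misses \<open>U\<close>
  entirely and meets each member of \<open>C\<close> in at most one point, because its direction
  \<open>w\<close> is in none of them. Infinitely many scalars leave a good
  \<open>c\<close>.\<close>

lemma exists_avoiding_subspaces:
  assumes inf: "infinite (UNIV :: 'a set)" and "finite C" and W: "subspace W"
    and C: "\<And>U. U \<in> C \<Longrightarrow> subspace U \<and> \<not> W \<subseteq> U"
  shows "\<exists>w \<in> W. \<forall>U \<in> C. w \<notin> U"
  using \<open>finite C\<close> C
proof (induction C rule: finite_induct)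
  case empty
  then show ?case using subspace_0[OF W] by blast
next
  case (insert U C)
  then obtain w where w: "w \<in> W" "\<forall>U \<in> C. w \<notin> U" by blast
  obtain v where v: "v \<in> W" "v \<notin> U" using insert.prems by blast
  show ?case
  proof (cases "w \<in> U")
    case False
    then show ?thesis using w by blast
  next
    case True
    have unique: "c = d" if "T \<in> C" "v + scale c w \<in> T" "v + scale d w \<in> T" for T c d
    proof (rule ccontr)
      assume "c \<noteq> d"
      have T: "subspace T" using insert.prems that by blast
      have "(v + scale c w) - (v + scale d w) \<in> T" by (rule subspace_diff[OF T]) fact+
      then have "scale (c - d) w \<in> T" by (simp add: scale_left_diff_distrib)
      then have "scale (inverse (c - d)) (scale (c - d) w) \<in> T" by (rule subspace_scale[OF T])
      then show False using \<open>c \<noteq> d\<close> w(2) \<open>T \<in> C\<close> by simp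
    qed
    have "finite {c. v + scale c w \<in> T}" if "T \<in> C" for T
    proof (cases "\<exists>d. v + scale d w \<in> T")
      case True
      then obtain d where "v + scale d w \<in> T" by blast
      then have "{c. v + scale c w \<in> T} \<subseteq> {d}" using unique[OF that] by blast
      then show ?thesis by (rule finite_subset) simp
    qed simp
    then have "finite (\<Union>T \<in> C. {c. v + scale c w \<in> T})" using insert.hyps by blast
    then obtain c where c: "c \<notin> (\<Union>T \<in> C. {c. v + scale c w \<in> T})"
      using inf by (metis ex_new_if_finite)
    have "v + scale c w \<notin> U"
      using v True insert.prems subspace_diff[of U "v + scale c w" "scale c w"] subspace_scale by fastforce
    moreover have "v + scale c w \<in> W" using v w W subspace_add subspace_scale by blast
    ultimately show ?thesis using c by blast
  qed
qed

text \<open>\<open>dim\<close> counts a basis with \<open>card\<close>, hence is 0 in the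
  infinite-dimensional case, and monotonicity needs a finite bound. The bound is a finite
  \<open>F\<close> whose span contains the sets in question instead of a finite-dimensional ambient
  space: a finitely generated module may have infinite dimension over the field, while each of its
  components is finite-dimensional.\<close>

lemma dim_mono_finite_span:
  assumes "finite F" "W \<subseteq> span F" "V \<subseteq> span W"
  shows "dim V \<le> dim W"
proof -
  obtain B where B: "B \<subseteq> W" "independent B" "W \<subseteq> span B" "card B = dim W"
    using basis_exists by blast
  have "finite B" using independent_span_bound[OF \<open>finite F\<close> B(2)] B(1) assms(2) by blast
  moreover have "V \<subseteq> span B" using B(3) assms(3) by (meson dual_order.trans span_minimal subspace_span)
  ultimately show ?thesis using dim_le_card B(4) by metis
qed

lemma dim_insert_finite_span:
  assumes "finite F" "S \<subseteq> span F" "x \<notin> span S"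
  shows "dim (insert x S) = Suc (dim S)"
proof -
  obtain B where B: "B \<subseteq> S" "independent B" "S \<subseteq> span B" "card B = dim S"
    using basis_exists by blast
  have "finite B" using independent_span_bound[OF \<open>finite F\<close> B(2)] B(1) assms(2) by blast
  have eq: "span B = span S" using B by (meson span_mono span_minimal subset_antisym subspace_span)
  have "x \<notin> B" using assms(3) eq span_base by blast
  then have "card (insert x B) = Suc (dim S)" using \<open>finite B\<close> B(4) by simp
  moreover have "independent (insert x B)" using assms(3) eq B(2) by (intro independent_insertI) auto
  moreover have "insert x S \<subseteq> span (insert x B)"
    using B(3) span_mono[of B "insert x B"] by (auto intro: span_base)
  moreover have "insert x B \<subseteq> insert x S" using B(1) by blast
  ultimately show ?thesis by (metis basis_card_eq_dim)
qed

lemma span_eq_if_card_eq_dim: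
  assumes "finite F" "V \<subseteq> span F" and V: "subspace V" and B: "B \<subseteq> V" "independent B" "card B = dim V"
  shows "span B = V"
proof
  show "span B \<subseteq> V" using B(1) V by (rule span_minimal)
  show "V \<subseteq> span B"
  proof
    fix x assume x: "x \<in> V"
    show "x \<in> span B"
    proof (rule ccontr)
      assume "x \<notin> span B"
      then have "dim (insert x B) = Suc (dim B)"
        using B(1) assms(2) by (intro dim_insert_finite_span[OF \<open>finite F\<close>]) auto
      moreover have "insert x B \<subseteq> span V" using x B(1) span_superset[of V] by blast
      then have "dim (insert x B) \<le> dim V"
        by (rule dim_mono_finite_span[OF assms(1,2)])
      ultimately show False using B(2,3) dim_eq_card_independent by simp
    qed
  qed
qed

text \<open>The dimension is at most the size of the image, which is at most \<open>card I\<close>.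
  The hypothesis closes this chain into equalities, so \<open>v\<close> is injective and the basis
  chosen inside the image is the whole image.\<close>

lemma independent_family_if_card_le_dim:
  assumes "finite I" "card I \<le> dim (v ` I)"
  shows "inj_on v I \<and> independent (v ` I)"
proof -
  obtain B where B: "B \<subseteq> v ` I" "independent B" "v ` I \<subseteq> span B" "card B = dim (v ` I)"
    using basis_exists by blast
  have "card B \<le> card (v ` I)" "card (v ` I) \<le> card I"
    using B(1) \<open>finite I\<close> by (auto intro: card_mono card_image_le)
  then have "card (v ` I) = card I" "B = v ` I"
    using B(1,4) assms card_subset_eq[of "v ` I" B] by auto
  then show ?thesis using B(2) \<open>finite I\<close> eq_card_imp_inj_on by blast
qed

text \<open>
  A simultaneous, generic version of Rado's theorem on independent transversals. The spaces are
  shrunk to points one index at a time; a vector \<open>w\<close> may replace \<open>W x\<close> unless \<open>f a x w\<close> falls into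
  the span of some tight set of other indices, and this excludes only finitely many proper
  subspaces of \<open>W x\<close>.
\<close>

lemma generic_independent_transversal:
  assumes inf: "infinite (UNIV :: 'a set)" and "finite I" "finite A"
    and W: "\<And>i. i \<in> I \<Longrightarrow> subspace (W i)"
    and P: "\<And>a. a \<in> A \<Longrightarrow> P a \<subseteq> I"
    and lin: "\<And>a i. a \<in> A \<Longrightarrow> i \<in> P a \<Longrightarrow> module_hom scale scale (f a i)"
    and F: "\<And>a. a \<in> A \<Longrightarrow> finite (F a)"
    and fW: "\<And>a i. a \<in> A \<Longrightarrow> i \<in> P a \<Longrightarrow> f a i ` W i \<subseteq> span (F a)"
    and rado: "\<And>a S. a \<in> A \<Longrightarrow> S \<subseteq> P a \<Longrightarrow> card S \<le> dim (\<Union>i\<in>S. f a i ` W i)"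
  shows "\<exists>w. (\<forall>i \<in> I. w i \<in> W i) \<and>
    (\<forall>a \<in> A. inj_on (\<lambda>i. f a i (w i)) (P a) \<and> independent ((\<lambda>i. f a i (w i)) ` P a))"
proof -
  \<comment> \<open>Indices in \<open>D\<close> are settled and contribute the point
    \<open>w i\<close>; the others still contribute all of \<open>W i\<close>. Rado's inequality for
    these mixed families is the invariant of the induction on \<open>D\<close>.\<close>
  define V where "V w D i = (if i \<in> D then {w i} else W i)" for w :: "'c \<Rightarrow> 'b" and D i
  have "\<exists>w. (\<forall>i \<in> D. w i \<in> W i) \<and>
      (\<forall>a \<in> A. \<forall>S \<subseteq> P a. card S \<le> dim (\<Union>i\<in>S. f a i ` V w D i))"
    if "finite D" "D \<subseteq> I" for D
    using that
  proof (induction D rule: finite_induct)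
    case empty
    then show ?case using rado by (auto simp: V_def)
  next
    case (insert x D)
    then obtain w where w: "\<forall>i \<in> D. w i \<in> W i"
      and card: "\<And>a S. a \<in> A \<Longrightarrow> S \<subseteq> P a \<Longrightarrow> card S \<le> dim (\<Union>i\<in>S. f a i ` V w D i)" by auto
    have xI: "x \<in> I" using insert by blast
    have VF: "(\<Union>i\<in>S. f a i ` V w D i) \<subseteq> span (F a)" if "a \<in> A" "S \<subseteq> P a" for a S
      using fW[OF that(1)] that(2) w unfolding V_def by (fastforce split: if_splits)
    define U where "U a S = span (\<Union>i\<in>S. f a i ` V w D i)" for a S
    \<comment> \<open>No test of tightness is made: every \<open>S\<close> whose span does not
      already contain the image of \<open>W x\<close> contributes the subspace of all
      \<open>y\<close> that are sent into this span. There are finitely many pairs, as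
      \<open>A\<close> and \<open>I\<close> are finite.\<close>
    define C where "C = (\<lambda>(a, S). {y. f a x y \<in> U a S}) `
      {(a, S). a \<in> A \<and> x \<in> P a \<and> S \<subseteq> P a - {x} \<and> \<not> f a x ` W x \<subseteq> U a S}"
    have "finite C" unfolding C_def
      using P finite_subset[OF _ \<open>finite I\<close>]
      by (intro finite_imageI finite_subset[OF _ finite_cartesian_product[OF \<open>finite A\<close>
              finite_Pow_iff[THEN iffD2, OF \<open>finite I\<close>]]]) blast
    moreover have "subspace T \<and> \<not> W x \<subseteq> T" if "T \<in> C" for T
    proof -
      from that obtain a S where T: "T = {y. f a x y \<in> U a S}" and a: "a \<in> A" "x \<in> P a"
        and "\<not> f a x ` W x \<subseteq> U a S" unfolding C_def by auto
      moreover have "subspace T" unfolding T U_def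
        by (rule module_hom.subspace_linear_preimage[OF lin[OF a]]) simp
      ultimately show ?thesis by blast
    qed
    ultimately obtain z where z: "z \<in> W x" and zC: "\<And>T. T \<in> C \<Longrightarrow> z \<notin> T"
      using exists_avoiding_subspaces[OF inf _ W[OF xI], of C] by blast
    define w' where "w' = w(x := z)"
    have V': "V w' (insert x D) i = (if i = x then {z} else V w D i)" for i
      by (simp add: V_def w'_def)
    have "card S \<le> dim (\<Union>i\<in>S. f a i ` V w' (insert x D) i)" if a: "a \<in> A" and S: "S \<subseteq> P a" for a S
    proof (cases "x \<in> S")
      case False
      then have "(\<Union>i\<in>S. f a i ` V w' (insert x D) i) = (\<Union>i\<in>S. f a i ` V w D i)"
        by (intro SUP_cong) (auto simp: V')
      then show ?thesis using card[OF a S] by simp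
    next
      case True
      let ?S = "S - {x}"
      let ?G = "\<Union>i\<in>?S. f a i ` V w D i"
      have finS: "finite S" using S P[OF a] \<open>finite I\<close> by (meson finite_subset)
      have S': "?S \<subseteq> P a" using S by blast
      have eq: "(\<Union>i\<in>S. f a i ` V w' (insert x D) i) = insert (f a x z) ?G"
      proof -
        have "(\<Union>i\<in>?S. f a i ` V w' (insert x D) i) = ?G"
          by (intro SUP_cong) (auto simp: V')
        moreover have "(\<Union>i\<in>insert x ?S. f a i ` V w' (insert x D) i) =
            f a x ` V w' (insert x D) x \<union> (\<Union>i\<in>?S. f a i ` V w' (insert x D) i)"
          by (rule UN_insert)
        moreover have "V w' (insert x D) x = {z}" by (simp add: V')
        ultimately show ?thesis unfolding insert_Diff[OF True] by simp
      qed
      have GF: "?G \<subseteq> span (F a)" using VF[OF a S'] .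
      have fzF: "insert (f a x z) ?G \<subseteq> span (F a)"
        using GF fW[OF a, of x] True S z by blast
      have cS: "card S = Suc (card ?S)" by (rule card_Suc_Diff1[OF finS True, symmetric])
      show ?thesis
      proof (cases "f a x ` W x \<subseteq> U a ?S")
        \<comment> \<open>Here \<open>z\<close> was chosen outside the preimage of the span, so its
          image adds one dimension to the inequality for \<open>?S\<close>.\<close>
        case False
        then have "f a x z \<notin> span ?G"
          using zC[of "{y. f a x y \<in> U a ?S}"] a True S unfolding C_def U_def by auto
        then have "dim (insert (f a x z) ?G) = Suc (dim ?G)"
          by (rule dim_insert_finite_span[OF F[OF a] GF])
        then show ?thesis using card[OF a S'] cS eq by simp
      next
        \<comment> \<open>The remaining vectors already span the image of all of \<open>W x\<close>,
          so shrinking \<open>W x\<close> to a point loses nothing and the old inequality for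
          \<open>S\<close> carries over.\<close>
        case sub: True
        have "(\<Union>i\<in>S. f a i ` V w D i) \<subseteq> span ?G"
        proof (rule UN_least)
          fix i assume "i \<in> S"
          show "f a i ` V w D i \<subseteq> span ?G"
          proof (cases "i = x")
            case True
            then show ?thesis using sub insert.hyps by (simp add: U_def V_def)
          next
            case False
            then have "f a i ` V w D i \<subseteq> ?G" using \<open>i \<in> S\<close> by blast
            then show ?thesis using span_superset by (rule subset_trans)
          qed
        qed
        also have "\<dots> \<subseteq> span (insert (f a x z) ?G)" by (rule span_mono) blast
        finally have "dim (\<Union>i\<in>S. f a i ` V w D i) \<le> dim (insert (f a x z) ?G)"
          by (rule dim_mono_finite_span[OF F[OF a] fzF])
        then show ?thesis using card[OF a S] eq by simp
      qed
    qed
    moreover have "\<forall>i \<in> insert x D. w' i \<in> W i" using w z by (simp add: w'_def)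
    ultimately show ?case by blast
  qed
  from this[OF \<open>finite I\<close>] obtain w where w: "\<forall>i \<in> I. w i \<in> W i"
    and card: "\<And>a. a \<in> A \<Longrightarrow> card (P a) \<le> dim (\<Union>i\<in>P a. f a i ` V w I i)" by blast
  have "inj_on (\<lambda>i. f a i (w i)) (P a) \<and> independent ((\<lambda>i. f a i (w i)) ` P a)" if "a \<in> A" for a
  proof (rule independent_family_if_card_le_dim)
    show "finite (P a)" using P[OF that] \<open>finite I\<close> by (rule finite_subset)
    have "(\<Union>i\<in>P a. f a i ` V w I i) = (\<Union>i\<in>P a. {f a i (w i)})"
      using P[OF that] by (intro SUP_cong) (auto simp: V_def)
    also have "\<dots> = (\<lambda>i. f a i (w i)) ` P a" by (rule UNION_singleton_eq_range)
    finally show "card (P a) \<le> dim ((\<lambda>i. f a i (w i)) ` P a)" using card[OF that] by simp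
  qed
  with w show ?thesis by (intro exI[of _ w]) simp
qed

text \<open>Functions vanishing off \<open>I\<close> are the coordinate vectors, so the bijection
  says that the family \<open>v\<close> is a basis of \<open>V\<close>. Independence is a property
  of sets; \<open>inj_on\<close> excludes repeated members of the family, which the image set would
  hide.\<close>

lemma bij_betw_combinations_iff:
  assumes "finite I"
  shows "bij_betw (\<lambda>c. \<Sum>i\<in>I. scale (c i) (v i)) {c. \<forall>i. i \<notin> I \<longrightarrow> c i = 0} V \<longleftrightarrow>
    inj_on v I \<and> independent (v ` I) \<and> span (v ` I) = V"
    (is "bij_betw ?L ?D V \<longleftrightarrow> _")
proof -
  have im: "?L ` ?D = span (v ` I)" if "inj_on v I"
  proof
    show "?L ` ?D \<subseteq> span (v ` I)"
      by (auto intro!: span_sum span_scale intro: span_base)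
    show "span (v ` I) \<subseteq> ?L ` ?D"
    proof
      fix x assume "x \<in> span (v ` I)"
      then obtain u where "x = (\<Sum>y\<in>v ` I. scale (u y) y)"
        using \<open>finite I\<close> by (auto simp: span_finite)
      then have "x = ?L (\<lambda>i. if i \<in> I then u (v i) else 0)"
        by (simp add: sum.reindex[OF that])
      moreover have "(\<lambda>i. if i \<in> I then u (v i) else 0) \<in> ?D" by simp
      ultimately show "x \<in> ?L ` ?D" by (rule image_eqI)
    qed
  qed
  show ?thesis
  proof
    assume bij: "bij_betw ?L ?D V"
    then have inj: "inj_on ?L ?D" by (simp add: bij_betw_def)
    have injv: "inj_on v I"
    proof (rule inj_onI)
      fix i j assume ij: "i \<in> I" "j \<in> I" "v i = v j"
      \<comment> \<open>Unit coordinate vectors: if \<open>v i\<close> and \<open>v j\<close> were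
        equal for different indices, two of them would have the same image.\<close>
      have L: "?L (\<lambda>k. if k = i then 1 else 0) = v i" if "i \<in> I" for i
        using that \<open>finite I\<close> by (simp add: if_distrib[of "\<lambda>c. scale c _"] cong: if_cong)
      have "(\<lambda>k. if k = i then 1 else (0::'a)) = (\<lambda>k. if k = j then 1 else 0)"
        using ij by (intro inj_onD[OF inj]) (auto simp: L)
      then show "i = j" by (metis zero_neq_one)
    qed
    moreover have "independent (v ` I)"
    proof (rule independent_if_scalars_zero)
      fix u x assume u: "(\<Sum>x\<in>v ` I. scale (u x) x) = 0" and "x \<in> v ` I"
      then obtain i where i: "i \<in> I" "x = v i" by blast
      have "(\<lambda>i. if i \<in> I then u (v i) else 0) = (\<lambda>i. 0)"
        using u by (intro inj_onD[OF inj]) (auto simp: sum.reindex[OF injv])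
      from fun_cong[OF this, of i] show "u x = 0" using i by simp
    qed (use \<open>finite I\<close> in simp)
    ultimately show "inj_on v I \<and> independent (v ` I) \<and> span (v ` I) = V"
      using im bij by (simp add: bij_betw_def)
  next
    assume R: "inj_on v I \<and> independent (v ` I) \<and> span (v ` I) = V"
    have "inj_on ?L ?D"
    proof (rule inj_onI)
      fix c d assume c: "c \<in> ?D" and d: "d \<in> ?D" and eq: "?L c = ?L d"
      \<comment> \<open>Independence tests scalars attached to vectors, so the difference of the
        coefficients is carried along the inverse of \<open>v\<close>.\<close>
      define u where "u x = c (the_inv_into I v x) - d (the_inv_into I v x)" for x
      have uv: "u (v i) = c i - d i" if "i \<in> I" for i
        using that R by (simp add: u_def the_inv_into_f_f)
      have "(\<Sum>x\<in>v ` I. scale (u x) x) = (\<Sum>i\<in>I. scale (c i - d i) (v i))"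
        using R uv by (simp add: sum.reindex)
      also have "\<dots> = 0" using eq by (simp add: scale_left_diff_distrib sum_subtractf)
      finally have "u x = 0" if "x \<in> v ` I" for x
        using independentD[of "v ` I" "v ` I" u x] R that \<open>finite I\<close> by blast
      then have "c i = d i" for i using uv c d by (cases "i \<in> I") (fastforce, auto)
      then show "c = d" by blast
    qed
    then show "bij_betw ?L ?D V" using R im by (simp add: bij_betw_def)
  qed
qed

end

subsection \<open>Homogeneous components and decompositions\<close>

lemma diff_vec_nonneg_iff [simp]: "0 \<le> a - b \<longleftrightarrow> b \<le> a" for a b :: "int ^ 'n"
  by (simp add: less_eq_vec_def)

lemma le_add_int_vec [simp]: "b \<le> b + int_vec t"
  by (simp add: less_eq_vec_def int_vec_def)

lemma int_vec_nat_vec: "0 \<le> a \<Longrightarrow> int_vec (nat_vec a) = a"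
  by (simp add: less_eq_vec_def int_vec_def nat_vec_def vec_eq_iff)

lemma nat_vec_int_vec [simp]: "nat_vec (int_vec t) = t"
  by (simp add: int_vec_def nat_vec_def vec_eq_iff)

lemma finite_int_vec_interval: "finite {a..b :: int ^ 'n::finite}"
proof (rule inj_on_finite)
  show "inj_on vec_nth {a..b}" by (simp add: inj_on_def vec_nth_inject)
  show "vec_nth ` {a..b} \<subseteq> PiE UNIV (\<lambda>i. {a $ i..b $ i})" by (auto simp: less_eq_vec_def)
  show "finite (PiE UNIV (\<lambda>i. {a $ i..b $ i}))" by (intro finite_PiE) auto
qed

lemma sum_single_lookup: "p = (\<Sum>t \<in> Poly_Mapping.keys p. Poly_Mapping.single t (Poly_Mapping.lookup p t))"
proof (rule poly_mapping_eqI)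
  fix t
  show "Poly_Mapping.lookup p t =
    Poly_Mapping.lookup (\<Sum>t \<in> Poly_Mapping.keys p. Poly_Mapping.single t (Poly_Mapping.lookup p t)) t"
    by (simp add: lookup_sum lookup_single when_def sum.If_cases in_keys_iff)
qed

lemma lookup_sum_single_family:
  "finite D \<Longrightarrow> Poly_Mapping.lookup (\<Sum>d\<in>D. Poly_Mapping.single d (y d)) a = (if a \<in> D then y a else 0)"
  by (simp add: lookup_sum lookup_single when_def)

lemma polys_in_add: "p \<in> polys_in Z \<Longrightarrow> q \<in> polys_in Z \<Longrightarrow> p + q \<in> polys_in Z"
  using keys_add[of p q] unfolding polys_in_def by blast

lemma polys_in_diff: "p \<in> polys_in Z \<Longrightarrow> q \<in> polys_in Z \<Longrightarrow> p - q \<in> polys_in Z"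
  using keys_diff[of p q] unfolding polys_in_def by blast

lemma polys_in_zero [simp]: "0 \<in> polys_in Z"
  by (simp add: polys_in_def)

lemma polys_in_single:
  assumes "0 \<le> a" "supp a \<subseteq> Z"
  shows "Poly_Mapping.single (nat_vec a) c \<in> polys_in Z"
  using assms by (auto simp: polys_in_def supp_def nat_vec_def)

lemma lookup_polys_in:
  assumes "p \<in> polys_in Z" "Poly_Mapping.lookup p t \<noteq> 0"
  shows "supp (int_vec t) \<subseteq> Z"
  using assms by (auto simp: polys_in_def supp_def int_vec_def in_keys_iff)

text \<open>The indices \<open>i\<close> for which \<open>K[Z i](-s i)\<close> is nonzero in degree \<open>a\<close>.\<close>

definition active :: "'i set \<Rightarrow> ('i \<Rightarrow> 'n set) \<Rightarrow> ('i \<Rightarrow> int ^ 'n) \<Rightarrow> int ^ 'n \<Rightarrow> 'i set" where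
  "active I Z s a = {i \<in> I. s i \<le> a \<and> supp (a - s i) \<subseteq> Z i}"

text \<open>The general element of degree \<open>a\<close> in the external direct sum, with
  coordinates \<open>c\<close>. The test for active indices also keeps \<open>nat_vec\<close> away
  from negative entries, which it would truncate to 0, giving a wrong monomial.\<close>

definition monomial_family ::
  "'i set \<Rightarrow> ('i \<Rightarrow> 'n set) \<Rightarrow> ('i \<Rightarrow> int ^ 'n) \<Rightarrow> int ^ 'n \<Rightarrow> ('i \<Rightarrow> 'k) \<Rightarrow> 'i \<Rightarrow> ('k::field, 'n::finite) mpol" where
  "monomial_family I Z s a c = (\<lambda>i. if i \<in> active I Z s a
     then Poly_Mapping.single (nat_vec (a - s i)) (c i) else 0)"

lemma finite_active: "finite I \<Longrightarrow> finite (active I Z s a)"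
  by (simp add: active_def)

lemma monomial_family_mem: "monomial_family I Z s a c \<in> ext_sum_comp I Z s a"
proof -
  have "monomial_family I Z s a c i \<in> polys_in (Z i)" for i
    by (auto simp: monomial_family_def active_def intro!: polys_in_single)
  moreover have "int_vec t = a - s i" if "t \<in> Poly_Mapping.keys (monomial_family I Z s a c i)" for i t
    using that by (auto simp: monomial_family_def active_def int_vec_nat_vec split: if_splits)
  moreover have "monomial_family I Z s a c i = 0" if "i \<notin> I" for i
    using that by (simp add: monomial_family_def active_def)
  ultimately show ?thesis unfolding ext_sum_comp_def ext_sum_def by blast
qed

lemma monomial_family_in_ext_sum: "monomial_family I Z s a c \<in> ext_sum I Z"
  using monomial_family_mem[of I Z s a c] by (simp add: ext_sum_comp_def)

context multigraded_module
begin

text \<open>Constants act as scalars. Through this interpretation the linear algebra above applies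
  to the module, and \<open>dim_K\<close> unfolds to \<open>K.dim\<close>.\<close>

sublocale K: vector_space "\<lambda>c. smul (const_poly c)"
proof
  show "smul (const_poly a) (smul (const_poly b) x) = smul (const_poly (a * b)) x" for a b x
    by (simp add: const_poly_def mult_single)
  show "smul (const_poly (a + b)) x = smul (const_poly a) x + smul (const_poly b) x" for a b x
    by (simp add: const_poly_def single_add scale_left_distrib)
  show "smul (const_poly 1) x = x" for x
    by (simp add: const_poly_def)
qed (simp add: scale_right_distrib)

lemma smul_single_nat_vec:
  "smul (Poly_Mapping.single (nat_vec a) c) x = smul (const_poly c) (smul (X_pow a) x)"
  by (simp add: const_poly_def X_pow_def mult_single)

lemma smul_const_mem: "x \<in> M a \<Longrightarrow> smul (const_poly c) x \<in> M a"
  using smul_mem[of x a 0 c] by (simp add: const_poly_def int_vec_def zero_vec_def[symmetric])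

lemma subspace_M: "K.subspace (M a)"
  by (intro K.subspaceI zero_mem add_mem smul_const_mem)

lemma smul_X_pow_mem: "x \<in> M b \<Longrightarrow> b \<le> a \<Longrightarrow> smul (X_pow (a - b)) x \<in> M a"
  using smul_mem[of x b "nat_vec (a - b)" 1] by (simp add: X_pow_def int_vec_nat_vec)

lemma module_hom_smul: "module_hom (\<lambda>c. smul (const_poly c)) (\<lambda>c. smul (const_poly c)) (smul p)"
  by (simp add: module_hom_iff K.module_axioms scale_right_distrib mult.commute)

section \<open>Projections onto the homogeneous components\<close>

definition components :: "'m \<Rightarrow> (int ^ 'n) \<Rightarrow>\<^sub>0 'm" where
  "components x = (THE v. (\<forall>a. Poly_Mapping.lookup v a \<in> M a) \<and>
     (\<Sum>a \<in> Poly_Mapping.keys v. Poly_Mapping.lookup v a) = x)"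

definition proj :: "int ^ 'n \<Rightarrow> 'm \<Rightarrow> 'm" where
  "proj a x = Poly_Mapping.lookup (components x) a"

lemma ex1_components: "\<exists>!v. (\<forall>a. Poly_Mapping.lookup v a \<in> M a) \<and>
     (\<Sum>a \<in> Poly_Mapping.keys v. Poly_Mapping.lookup v a) = x"
  using direct_sum unfolding is_direct_sum_def by simp

lemma proj_mem: "proj a x \<in> M a"
  using theI'[OF ex1_components[of x]] unfolding proj_def components_def by blast

lemma sum_proj: "(\<Sum>a \<in> Poly_Mapping.keys (components x). proj a x) = x"
  using theI'[OF ex1_components[of x]] unfolding proj_def components_def by blast

lemma sum_proj_superset:
  assumes "finite D" "Poly_Mapping.keys (components x) \<subseteq> D"
  shows "(\<Sum>a\<in>D. proj a x) = x"
proof -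
  have "(\<Sum>a\<in>D. proj a x) = (\<Sum>a \<in> Poly_Mapping.keys (components x). proj a x)"
    using assms by (intro sum.mono_neutral_right) (auto simp: proj_def in_keys_iff)
  then show ?thesis by (simp add: sum_proj)
qed

text \<open>Uniqueness in the direct sum: a finite sum of homogeneous elements of distinct degrees
  is itself the decomposition of its value.\<close>

lemma proj_sum_homogeneous:
  assumes "finite D" "\<And>d. d \<in> D \<Longrightarrow> y d \<in> M d"
  shows "proj a (\<Sum>d\<in>D. y d) = (if a \<in> D then y a else 0)"
proof -
  let ?v = "\<Sum>d\<in>D. Poly_Mapping.single d (y d)"
  note lookup = lookup_sum_single_family[OF assms(1), of y]
  have "(\<Sum>a \<in> Poly_Mapping.keys ?v. Poly_Mapping.lookup ?v a) = (\<Sum>d\<in>D. y d)"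
    using assms(1) by (intro sum.mono_neutral_cong_left) (auto simp: in_keys_iff lookup split: if_splits)
  moreover have "\<forall>a. Poly_Mapping.lookup ?v a \<in> M a"
    using assms(2) zero_mem by (simp add: lookup)
  ultimately have "components (\<Sum>d\<in>D. y d) = ?v"
    unfolding components_def by (intro the1_equality[OF ex1_components]) simp
  then show ?thesis by (simp add: proj_def lookup)
qed

lemma proj_homogeneous: "x \<in> M b \<Longrightarrow> proj a x = (if a = b then x else 0)"
  using proj_sum_homogeneous[of "{b}" "\<lambda>_. x" a] by auto

lemma M_disjoint: "x \<in> M a \<Longrightarrow> x \<in> M b \<Longrightarrow> x \<noteq> 0 \<Longrightarrow> a = b"
  using proj_homogeneous[of x a a] proj_homogeneous[of x b a] by (auto split: if_splits)

lemma hdeg_eq: "x \<in> M a \<Longrightarrow> x \<noteq> 0 \<Longrightarrow> hdeg M x = a"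
  unfolding hdeg_def using M_disjoint by blast

lemma proj_zero [simp]: "proj a 0 = 0"
  using proj_sum_homogeneous[of "{}"] by simp

lemma proj_add: "proj a (x + y) = proj a x + proj a y"
proof -
  let ?D = "Poly_Mapping.keys (components x) \<union> Poly_Mapping.keys (components y)"
  have "x + y = (\<Sum>d\<in>?D. proj d x + proj d y)"
    by (simp add: sum.distrib sum_proj_superset)
  then have "proj a (x + y) = (if a \<in> ?D then proj a x + proj a y else 0)"
    by (simp only:) (intro proj_sum_homogeneous, auto intro: add_mem proj_mem)
  then show ?thesis by (auto simp: proj_def in_keys_iff)
qed

lemma proj_sum: "proj a (\<Sum>i\<in>I. x i) = (\<Sum>i\<in>I. proj a (x i))"
  by (induction I rule: infinite_finite_induct) (simp_all add: proj_add)

lemma smul_eq_sum: "smul p x = (\<Sum>t \<in> Poly_Mapping.keys p. smul (Poly_Mapping.single t (Poly_Mapping.lookup p t)) x)"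
  by (subst sum_single_lookup[of p]) (rule scale_sum_left)

text \<open>Distinct exponents move \<open>x\<close> to distinct degrees, so the part of degree
  \<open>a\<close> comes from the single exponent \<open>a - b\<close>. Unless
  \<open>b \<le> a\<close> there is no such exponent, and \<open>nat_vec\<close> would truncate to a
  wrong one.\<close>

lemma proj_smul_homogeneous:
  assumes "x \<in> M b"
  shows "proj a (smul p x) =
    (if b \<le> a then smul (const_poly (Poly_Mapping.lookup p (nat_vec (a - b)))) (smul (X_pow (a - b)) x) else 0)"
proof -
  let ?D = "(\<lambda>t. b + int_vec t) ` Poly_Mapping.keys p"
  define y where "y d = smul (Poly_Mapping.single (nat_vec (d - b)) (Poly_Mapping.lookup p (nat_vec (d - b)))) x" for d
  have inj: "inj_on (\<lambda>t. b + int_vec t) (Poly_Mapping.keys p)"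
    by (rule inj_onI) (metis add_left_cancel nat_vec_int_vec)
  have "smul p x = (\<Sum>d\<in>?D. y d)"
    by (subst smul_eq_sum) (simp add: sum.reindex[OF inj] y_def)
  moreover have "y d \<in> M d" if "d \<in> ?D" for d
    using that smul_mem[OF assms] by (auto simp: y_def)
  ultimately have "proj a (smul p x) = (if a \<in> ?D then y a else 0)"
    by (simp only:) (rule proj_sum_homogeneous, auto)
  moreover have "a \<in> ?D \<longleftrightarrow> b \<le> a \<and> nat_vec (a - b) \<in> Poly_Mapping.keys p"
    by (auto simp: int_vec_nat_vec intro!: rev_image_eqI[of "nat_vec (a - b)"])
  ultimately show ?thesis
    by (auto simp: y_def in_keys_iff smul_single_nat_vec simp del: scale_scale)
qed

section \<open>Evaluation at homogeneous generators, one degree at a time\<close>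

definition gen_map :: "'i set \<Rightarrow> ('i \<Rightarrow> 'm) \<Rightarrow> ('i \<Rightarrow> ('k, 'n) mpol) \<Rightarrow> 'm" where
  "gen_map I m f = (\<Sum>i\<in>I. smul (f i) (m i))"

text \<open>This is \<open>gen_map\<close> in degree \<open>a\<close>: each active index contributes
  exactly one monomial, so only its scalar coefficient is free.\<close>

definition combination ::
  "'i set \<Rightarrow> ('i \<Rightarrow> 'n set) \<Rightarrow> ('i \<Rightarrow> int ^ 'n) \<Rightarrow> ('i \<Rightarrow> 'm) \<Rightarrow> int ^ 'n \<Rightarrow> ('i \<Rightarrow> 'k) \<Rightarrow> 'm" where
  "combination I Z s m a c =
    (\<Sum>i\<in>active I Z s a. smul (const_poly (c i)) (smul (X_pow (a - s i)) (m i)))"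

definition coefficients :: "'i set \<Rightarrow> ('i \<Rightarrow> 'n set) \<Rightarrow> ('i \<Rightarrow> int ^ 'n) \<Rightarrow> int ^ 'n \<Rightarrow> ('i \<Rightarrow> 'k) set" where
  "coefficients I Z s a = {c. \<forall>i. i \<notin> active I Z s a \<longrightarrow> c i = 0}"

lemma gen_map_add: "gen_map I m (\<lambda>i. f i + h i) = gen_map I m f + gen_map I m h"
  by (simp add: gen_map_def scale_left_distrib sum.distrib)

lemma gen_map_const_mult: "gen_map I m (\<lambda>i. const_poly c * f i) = smul (const_poly c) (gen_map I m f)"
  by (simp add: gen_map_def scale_sum_right)

lemma gen_map_sum: "gen_map I m (\<lambda>i. \<Sum>d\<in>D. f d i) = (\<Sum>d\<in>D. gen_map I m (f d))"
  unfolding gen_map_def by (simp add: scale_sum_left) (rule sum.swap)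

lemma gen_map_monomial_family:
  assumes "finite I"
  shows "gen_map I m (monomial_family I Z s a c) = combination I Z s m a c"
  unfolding gen_map_def combination_def
  using assms by (intro sum.mono_neutral_cong_right)
    (auto simp: monomial_family_def active_def smul_single_nat_vec simp del: scale_scale)

lemma proj_gen_map:
  assumes "finite I" and m: "\<forall>i\<in>I. m i \<in> M (s i)" and f: "f \<in> ext_sum I Z"
  shows "proj a (gen_map I m f) = combination I Z s m a (\<lambda>i. Poly_Mapping.lookup (f i) (nat_vec (a - s i)))"
proof -
  have "Poly_Mapping.lookup (f i) (nat_vec (a - s i)) = 0"
    if "i \<in> I" "s i \<le> a" "i \<notin> active I Z s a" for i
    using that f lookup_polys_in[of "f i" "Z i" "nat_vec (a - s i)"]
    by (auto simp: active_def ext_sum_def int_vec_nat_vec)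
  then have "proj a (smul (f i) (m i)) = (if i \<in> active I Z s a
      then smul (const_poly (Poly_Mapping.lookup (f i) (nat_vec (a - s i)))) (smul (X_pow (a - s i)) (m i))
      else 0)" if "i \<in> I" for i
    using that by (cases "i \<in> active I Z s a")
      (auto simp: proj_smul_homogeneous[OF bspec[OF m that]] active_def simp del: scale_scale)
  then show ?thesis unfolding gen_map_def combination_def proj_sum
    using assms(1) by (intro sum.mono_neutral_cong_right) (auto simp: active_def simp del: scale_scale)
qed

lemma combination_mem:
  assumes m: "\<forall>i\<in>I. m i \<in> M (s i)"
  shows "combination I Z s m a c \<in> M a"
  unfolding combination_def
  by (rule K.subspace_sum[OF subspace_M]) (auto simp: active_def simp del: scale_scale intro!: smul_const_mem smul_X_pow_mem bspec[OF m])

lemma combination_restrict: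
  "combination I Z s m a (\<lambda>i. if i \<in> active I Z s a then c i else 0) = combination I Z s m a c"
  by (simp add: combination_def)

text \<open>The map respects degrees. From left to right, monomial families embed the coordinates of
  degree \<open>a\<close>, and projecting a preimage to degree \<open>a\<close> yields coordinates
  of an element of \<open>M a\<close>. Conversely, every coefficient of a polynomial family is
  visible in exactly one degree, and an element is assembled from its finitely many nonzero
  components.\<close>

lemma bij_betw_gen_map_iff:
  assumes "finite I" and m: "\<forall>i\<in>I. m i \<in> M (s i)"
  shows "bij_betw (gen_map I m) (ext_sum I Z) UNIV \<longleftrightarrow>
    (\<forall>a. bij_betw (combination I Z s m a) (coefficients I Z s a) (M a))"
    (is "?L \<longleftrightarrow> ?R")
proof
  assume L: ?L
  show ?R
  proof
    fix a
    have "inj_on (combination I Z s m a) (coefficients I Z s a)"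
    proof (rule inj_onI)
      fix c d assume c: "c \<in> coefficients I Z s a" "d \<in> coefficients I Z s a"
        and eq: "combination I Z s m a c = combination I Z s m a d"
      have "monomial_family I Z s a c = monomial_family I Z s a d"
      proof (rule inj_onD[OF bij_betw_imp_inj_on[OF L]])
        show "gen_map I m (monomial_family I Z s a c) = gen_map I m (monomial_family I Z s a d)"
          using eq by (simp add: gen_map_monomial_family[OF assms(1)])
      qed (rule monomial_family_in_ext_sum)+
      note eq' = fun_cong[OF this]
      have "c i = d i" for i
      proof (cases "i \<in> active I Z s a")
        case True
        then have "Poly_Mapping.single (nat_vec (a - s i)) (c i) = Poly_Mapping.single (nat_vec (a - s i)) (d i)"
          using eq'[of i] by (simp add: monomial_family_def)
        then show ?thesis by (metis lookup_single_eq)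
      next
        case False
        then show ?thesis using c by (simp add: coefficients_def)
      qed
      then show "c = d" by blast
    qed
    moreover have "M a \<subseteq> combination I Z s m a ` coefficients I Z s a"
    proof
      fix x assume x: "x \<in> M a"
      obtain f where f: "f \<in> ext_sum I Z" "x = gen_map I m f"
        using L by (metis UNIV_I bij_betw_imp_surj_on imageE)
      let ?c = "\<lambda>i. Poly_Mapping.lookup (f i) (nat_vec (a - s i))"
      have "x = combination I Z s m a ?c"
        using proj_homogeneous[OF x, of a] proj_gen_map[OF assms f(1)] f(2) by simp
      then have x': "x = combination I Z s m a (\<lambda>i. if i \<in> active I Z s a then ?c i else 0)"
        by (simp only: combination_restrict)
      have "(\<lambda>i. if i \<in> active I Z s a then ?c i else 0) \<in> coefficients I Z s a"
        by (simp add: coefficients_def)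
      with x' show "x \<in> combination I Z s m a ` coefficients I Z s a" by (rule image_eqI)
    qed
    ultimately show "bij_betw (combination I Z s m a) (coefficients I Z s a) (M a)"
      using combination_mem[OF m] by (auto simp: bij_betw_def)
  qed
next
  assume R: ?R
  have "inj_on (gen_map I m) (ext_sum I Z)"
  proof (rule inj_onI)
    fix f h assume f: "f \<in> ext_sum I Z" and h: "h \<in> ext_sum I Z" and eq: "gen_map I m f = gen_map I m h"
    have "f i = h i" if i: "i \<in> I" for i
    proof (rule poly_mapping_eqI)
      fix t
      \<comment> \<open>The coefficient at exponent \<open>t\<close> in entry \<open>i\<close> is
        read off in this degree.\<close>
      let ?a = "s i + int_vec t"
      show "Poly_Mapping.lookup (f i) t = Poly_Mapping.lookup (h i) t"
      proof (cases "i \<in> active I Z s ?a")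
        case True
        define c where "c f j = (if j \<in> active I Z s ?a then Poly_Mapping.lookup (f j) (nat_vec (?a - s j)) else 0)"
          for f :: "_ \<Rightarrow> ('k, 'n) mpol" and j
        have "combination I Z s m ?a (c f) = proj ?a (gen_map I m f)" if "f \<in> ext_sum I Z" for f
          unfolding proj_gen_map[OF assms that] c_def[abs_def] by (rule combination_restrict)
        then have "combination I Z s m ?a (c f) = combination I Z s m ?a (c h)"
          using f h eq by simp
        then have "c f = c h"
          by (rule inj_onD[OF bij_betw_imp_inj_on[OF R[rule_format, of ?a]]]) (auto simp: c_def coefficients_def)
        from fun_cong[OF this, of i] show ?thesis using True by (simp add: c_def)
      next
        case False
        then have "\<not> supp (int_vec t) \<subseteq> Z i"
          using i by (simp add: active_def)
        then have "Poly_Mapping.lookup p t = 0" if "p \<in> polys_in (Z i)" for p :: "('k, 'n) mpol"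
          using lookup_polys_in[OF that, of t] by blast
        then show ?thesis using f h i by (simp add: ext_sum_def)
      qed
    qed
    moreover have "f i = h i" if "i \<notin> I" for i using that f h by (simp add: ext_sum_def)
    ultimately show "f = h" by blast
  qed
  moreover have "x \<in> gen_map I m ` ext_sum I Z" for x
  proof -
    have "\<exists>c. proj a x = combination I Z s m a c" for a
      using R proj_mem[of a x] unfolding bij_betw_def by (metis imageE)
    then obtain c where c: "\<And>a. proj a x = combination I Z s m a (c a)" by metis
    let ?D = "Poly_Mapping.keys (components x)"
    have x: "x = gen_map I m (\<lambda>i. \<Sum>d\<in>?D. monomial_family I Z s d (c d) i)"
      by (subst sum_proj[symmetric]) (simp add: gen_map_sum gen_map_monomial_family[OF assms(1)] c)
    have "(\<lambda>i. \<Sum>d\<in>D. monomial_family I Z s d (c d) i) \<in> ext_sum I Z" if "finite D" for D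
      using that
    proof (induction D rule: finite_induct)
      case empty
      then show ?case by (simp add: ext_sum_def)
    next
      case (insert d D)
      then show ?case using monomial_family_in_ext_sum[of I Z s d "c d"]
        by (simp add: ext_sum_def polys_in_add)
    qed
    from this[OF finite_keys] show ?thesis by (rule image_eqI[where f = "gen_map I m", OF x])
  qed
  ultimately show ?L by (auto simp: bij_betw_def)
qed

text \<open>The map that exhibits the \<open>m i\<close> as a Stanley decomposition is also the
  graded isomorphism required of the induced Hilbert decomposition.\<close>

lemma hilbert_decomposition_gen_map:
  assumes "finite I" and m: "\<forall>i\<in>I. m i \<in> M (s i)"
    and bij: "bij_betw (gen_map I m) (ext_sum I Z) UNIV"
  shows "hilbert_decomposition smul M I Z s"
proof -
  have "gen_map I m ` ext_sum_comp I Z s a = M a" for a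
  proof
    show "gen_map I m ` ext_sum_comp I Z s a \<subseteq> M a"
    proof (rule image_subsetI)
      fix f :: "_ \<Rightarrow> ('k, 'n) mpol" assume f: "f \<in> ext_sum_comp I Z s a"
      have "smul (f i) (m i) \<in> M a" if "i \<in> I" for i
      proof (subst smul_eq_sum, rule K.subspace_sum[OF subspace_M])
        fix t assume "t \<in> Poly_Mapping.keys (f i)"
        then have "int_vec t = a - s i" using f that by (simp add: ext_sum_comp_def)
        then show "smul (Poly_Mapping.single t (Poly_Mapping.lookup (f i) t)) (m i) \<in> M a"
          using smul_mem[OF bspec[OF m that], of t] by simp
      qed
      then show "gen_map I m f \<in> M a" unfolding gen_map_def by (rule K.subspace_sum[OF subspace_M])
    qed
    show "M a \<subseteq> gen_map I m ` ext_sum_comp I Z s a"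
    proof
      fix x assume "x \<in> M a"
      moreover have "combination I Z s m a ` coefficients I Z s a = M a"
        using bij bij_betw_imp_surj_on unfolding bij_betw_gen_map_iff[OF assms(1,2)] by blast
      ultimately obtain c where "x = combination I Z s m a c" by blast
      then have "x = gen_map I m (monomial_family I Z s a c)"
        by (simp only: gen_map_monomial_family[OF assms(1)])
      then show "x \<in> gen_map I m ` ext_sum_comp I Z s a"
        using monomial_family_mem by (rule image_eqI)
    qed
  qed
  then show ?thesis unfolding hilbert_decomposition_def
    using assms(1) bij by (intro conjI exI[of _ "gen_map I m"]) (simp_all add: gen_map_add gen_map_const_mult)
qed

text \<open>Injectivity has two sources: the direct sum determines each summand
  \<open>smul (f i) (m i)\<close>, and the annihilator condition determines \<open>f i\<close> from
  that summand.\<close>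

lemma bij_betw_gen_map_if_stanley:
  assumes stanley: "stanley_decomposition smul M I Z m"
  shows "bij_betw (gen_map I m) (ext_sum I Z) UNIV"
proof -
  let ?V = "\<lambda>i. (\<lambda>p. smul p (m i)) ` polys_in (Z i)"
  have "finite I" using stanley by (simp add: stanley_decomposition_def)
  have ann: "p = 0" if "i \<in> I" "p \<in> polys_in (Z i)" "smul p (m i) = 0" for i p
  proof -
    have "polys_in (Z i) \<inter> {p. smul p (m i) = 0} = {0}"
      using stanley that(1) by (simp add: stanley_decomposition_def)
    then show ?thesis using that by blast
  qed
  have "is_direct_sum I ?V" using stanley by (simp add: stanley_decomposition_def)
  note ds = this[unfolded is_direct_sum_def, rule_format]
  have "inj_on (gen_map I m) (ext_sum I Z)"
  proof (rule inj_onI)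
    fix f h assume f: "f \<in> ext_sum I Z" and h: "h \<in> ext_sum I Z" and eq: "gen_map I m f = gen_map I m h"
    define v where "v f = (\<Sum>i\<in>I. Poly_Mapping.single i (smul (f i) (m i)))"
      for f :: "_ \<Rightarrow> ('k, 'n) mpol"
    have lookup: "Poly_Mapping.lookup (v f) i = (if i \<in> I then smul (f i) (m i) else 0)" for f i
      unfolding v_def by (rule lookup_sum_single_family[OF \<open>finite I\<close>])
    have keys: "Poly_Mapping.keys (v f) \<subseteq> I" for f by (auto simp: in_keys_iff lookup split: if_splits)
    have sum: "(\<Sum>i \<in> Poly_Mapping.keys (v f). Poly_Mapping.lookup (v f) i) = gen_map I m f" for f
      unfolding gen_map_def using \<open>finite I\<close> keys
      by (intro sum.mono_neutral_cong_left) (auto simp: in_keys_iff lookup)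
    have "\<forall>i \<in> I. Poly_Mapping.lookup (v f) i \<in> ?V i" "\<forall>i \<in> I. Poly_Mapping.lookup (v h) i \<in> ?V i"
      using f h by (simp_all add: lookup ext_sum_def)
    then have "v f = v h"
      using keys[of f] keys[of h] sum[of f] sum[of h] eq ds[of "gen_map I m f"] by metis
    have "f i = h i" if i: "i \<in> I" for i
    proof -
      have "smul (f i) (m i) = smul (h i) (m i)"
        using arg_cong[OF \<open>v f = v h\<close>, of "\<lambda>v. Poly_Mapping.lookup v i"] i by (simp add: lookup)
      then have "smul (f i - h i) (m i) = 0" by (simp add: scale_left_diff_distrib)
      then show "f i = h i" using ann[OF i polys_in_diff] f h i by (auto simp: ext_sum_def)
    qed
    moreover have "f i = h i" if "i \<notin> I" for i using that f h by (simp add: ext_sum_def)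
    ultimately show "f = h" by blast
  qed
  moreover have "x \<in> gen_map I m ` ext_sum I Z" for x
  proof -
    obtain v where v: "Poly_Mapping.keys v \<subseteq> I" "\<And>i. i \<in> I \<Longrightarrow> Poly_Mapping.lookup v i \<in> ?V i"
      "(\<Sum>i \<in> Poly_Mapping.keys v. Poly_Mapping.lookup v i) = x" using ds[of x] by blast
    have "\<exists>p. p \<in> polys_in (Z i) \<and> Poly_Mapping.lookup v i = smul p (m i)" if "i \<in> I" for i
      using v(2)[OF that] by blast
    then obtain p where p: "\<And>i. i \<in> I \<Longrightarrow> p i \<in> polys_in (Z i) \<and> Poly_Mapping.lookup v i = smul (p i) (m i)"
      by metis
    let ?f = "\<lambda>i. if i \<in> I then p i else 0"
    have "x = gen_map I m ?f"
      unfolding gen_map_def v(3)[symmetric]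
      using \<open>finite I\<close> v(1) p by (intro sum.mono_neutral_cong_left) (auto simp: in_keys_iff)
    moreover have "?f \<in> ext_sum I Z" using p by (simp add: ext_sum_def)
    ultimately show ?thesis by (rule image_eqI)
  qed
  ultimately show ?thesis by (auto simp: bij_betw_def)
qed

lemma stanley_if_bij_betw_gen_map:
  assumes "finite I" and m: "\<forall>i\<in>I. m i \<in> M (s i)"
    and bij: "bij_betw (gen_map I m) (ext_sum I Z) UNIV"
  shows "stanley_decomposition smul M I Z m"
proof -
  let ?V = "\<lambda>i. (\<lambda>p. smul p (m i)) ` polys_in (Z i)"
  have "p = 0" if i: "i \<in> I" and p: "p \<in> polys_in (Z i)" "smul p (m i) = 0" for i p
  proof -
    \<comment> \<open>The family concentrated at \<open>i\<close> turns an annihilator of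
      \<open>m i\<close> into a kernel element of \<open>gen_map\<close>.\<close>
    have "gen_map I m (\<lambda>j. if j = i then p else 0) = gen_map I m (\<lambda>j. 0)"
      unfolding gen_map_def using p(2) by (intro sum.cong) auto
    then have "(\<lambda>j. if j = i then p else 0) = (\<lambda>j. 0)"
      using i p(1) by (rule_tac inj_onD[OF bij_betw_imp_inj_on[OF bij]]) (auto simp: ext_sum_def)
    from fun_cong[OF this, of i] show "p = 0" by simp
  qed
  moreover have "is_direct_sum I ?V"
    unfolding is_direct_sum_def
  proof (intro allI ex_ex1I)
    fix x
    obtain f where f: "f \<in> ext_sum I Z" "x = gen_map I m f"
      using bij by (metis UNIV_I bij_betw_imp_surj_on imageE)
    define v where "v = (\<Sum>i\<in>I. Poly_Mapping.single i (smul (f i) (m i)))"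
    have lookup: "Poly_Mapping.lookup v i = (if i \<in> I then smul (f i) (m i) else 0)" for i
      unfolding v_def by (rule lookup_sum_single_family[OF assms(1)])
    have keys: "Poly_Mapping.keys v \<subseteq> I" by (auto simp: in_keys_iff lookup split: if_splits)
    have sum: "(\<Sum>i \<in> Poly_Mapping.keys v. Poly_Mapping.lookup v i) = x"
      unfolding gen_map_def f(2) using \<open>finite I\<close> keys
      by (intro sum.mono_neutral_cong_left) (auto simp: in_keys_iff lookup)
    have "\<forall>i \<in> I. Poly_Mapping.lookup v i \<in> ?V i"
      using f(1) by (simp add: lookup ext_sum_def)
    then show "\<exists>v. Poly_Mapping.keys v \<subseteq> I \<and> (\<forall>i \<in> I. Poly_Mapping.lookup v i \<in> ?V i) \<and>
        (\<Sum>i \<in> Poly_Mapping.keys v. Poly_Mapping.lookup v i) = x" using keys sum by blast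
  next
    fix x v w
    assume v: "Poly_Mapping.keys v \<subseteq> I \<and> (\<forall>i \<in> I. Poly_Mapping.lookup v i \<in> ?V i) \<and>
        (\<Sum>i \<in> Poly_Mapping.keys v. Poly_Mapping.lookup v i) = x"
      and w: "Poly_Mapping.keys w \<subseteq> I \<and> (\<forall>i \<in> I. Poly_Mapping.lookup w i \<in> ?V i) \<and>
        (\<Sum>i \<in> Poly_Mapping.keys w. Poly_Mapping.lookup w i) = x"
    \<comment> \<open>A decomposition of \<open>x\<close> lifts to a polynomial family over
      \<open>x\<close>; injectivity of \<open>gen_map\<close> makes two such families, hence two
      decompositions, equal.\<close>
    have rep: "\<exists>f. f \<in> ext_sum I Z \<and> gen_map I m f = x \<and> (\<forall>i\<in>I. Poly_Mapping.lookup v i = smul (f i) (m i))"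
      if v: "Poly_Mapping.keys v \<subseteq> I \<and> (\<forall>i \<in> I. Poly_Mapping.lookup v i \<in> ?V i) \<and>
        (\<Sum>i \<in> Poly_Mapping.keys v. Poly_Mapping.lookup v i) = x" for v
    proof -
      have "\<exists>p. p \<in> polys_in (Z i) \<and> Poly_Mapping.lookup v i = smul p (m i)" if "i \<in> I" for i
        using v that by blast
      then obtain p where p: "\<And>i. i \<in> I \<Longrightarrow> p i \<in> polys_in (Z i) \<and> Poly_Mapping.lookup v i = smul (p i) (m i)"
        by metis
      let ?f = "\<lambda>i. if i \<in> I then p i else 0"
      have "(\<Sum>i \<in> Poly_Mapping.keys v. Poly_Mapping.lookup v i) = gen_map I m ?f"
        unfolding gen_map_def
        using \<open>finite I\<close> v p by (intro sum.mono_neutral_cong_left) (auto simp: in_keys_iff)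
      moreover have "?f \<in> ext_sum I Z" using p by (simp add: ext_sum_def)
      ultimately show ?thesis using v p by (intro exI[of _ ?f]) simp
    qed
    from rep[OF v] rep[OF w] obtain f h where f: "f \<in> ext_sum I Z" "gen_map I m f = x"
        "\<And>i. i \<in> I \<Longrightarrow> Poly_Mapping.lookup v i = smul (f i) (m i)"
      and h: "h \<in> ext_sum I Z" "gen_map I m h = x"
        "\<And>i. i \<in> I \<Longrightarrow> Poly_Mapping.lookup w i = smul (h i) (m i)" by blast
    have "f = h" using f h by (intro inj_onD[OF bij_betw_imp_inj_on[OF bij]]) auto
    have zero: "Poly_Mapping.lookup v i = 0" if "Poly_Mapping.keys v \<subseteq> I" "i \<notin> I" for v :: "_ \<Rightarrow>\<^sub>0 'm" and i
      using that by (metis in_keys_iff subsetD)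
    show "v = w"
    proof (rule poly_mapping_eqI)
      fix i
      show "Poly_Mapping.lookup v i = Poly_Mapping.lookup w i"
        using f(3) h(3) \<open>f = h\<close> v w by (cases "i \<in> I") (simp_all add: zero)
    qed
  qed
  ultimately show ?thesis
    unfolding stanley_decomposition_def using assms(1) m by auto
qed

text \<open>Degree \<open>a\<close> is spanned by the finitely many monomial multiples of components
  of generators that land there: \<open>X_pow (a - d)\<close> times a component of degree
  \<open>d\<close>. This makes \<open>K.dim\<close> a true dimension on every
  \<open>M a\<close>.\<close>

lemma finite_dimensional_component:
  assumes "finitely_generated smul"
  shows "\<exists>F. finite F \<and> M a \<subseteq> K.span F"
proof -
  obtain S where "finite S" and S: "span S = UNIV"
    using assms unfolding finitely_generated_def by blast
  define F where "F a = (\<Union>x\<in>S. \<Union>d\<in>{d \<in> Poly_Mapping.keys (components x). d \<le> a}.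
      {smul (X_pow (a - d)) (proj d x)})" for a
  have finF: "finite (F a)" for a unfolding F_def using \<open>finite S\<close> by simp
  \<comment> \<open>A term with exponent \<open>t\<close> takes the spanning vectors of degree
    \<open>a\<close> to scalar multiples of those of degree \<open>a + int_vec t\<close>.\<close>
  have step: "smul (Poly_Mapping.single t c) y \<in> K.span (F (a + int_vec t))" if "y \<in> K.span (F a)" for a t c y
  proof -
    have "smul (Poly_Mapping.single t c) ` F a \<subseteq> K.span (F (a + int_vec t))"
    proof (rule image_subsetI)
      fix z assume "z \<in> F a"
      then obtain x d where x: "x \<in> S" "d \<in> Poly_Mapping.keys (components x)" "d \<le> a"
        and z: "z = smul (X_pow (a - d)) (proj d x)" unfolding F_def by blast
      have "nat_vec (a + int_vec t - d) = t + nat_vec (a - d)"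
        unfolding vec_eq_iff
      proof
        fix i
        have "d $ i \<le> a $ i" using x(3) by (simp add: less_eq_vec_def)
        then have "nat (a $ i + int (t $ i) - d $ i) = t $ i + nat (a $ i - d $ i)" by linarith
        then show "nat_vec (a + int_vec t - d) $ i = (t + nat_vec (a - d)) $ i"
          by (simp add: nat_vec_def int_vec_def)
      qed
      then have "smul (Poly_Mapping.single t c) z = smul (const_poly c) (smul (X_pow (a + int_vec t - d)) (proj d x))"
        by (simp add: z X_pow_def const_poly_def mult_single)
      moreover have "d \<le> a + int_vec t"
        using x(3) by (auto simp: less_eq_vec_def int_vec_def intro: add_increasing2)
      then have "smul (X_pow (a + int_vec t - d)) (proj d x) \<in> F (a + int_vec t)"
        using x unfolding F_def by blast
      ultimately show "smul (Poly_Mapping.single t c) z \<in> K.span (F (a + int_vec t))"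
        by (simp only: K.span_scale K.span_base)
    qed
    then have "K.span (smul (Poly_Mapping.single t c) ` F a) \<subseteq> K.span (F (a + int_vec t))"
      by (rule K.span_minimal) simp
    then show ?thesis using that module_hom.span_image[OF module_hom_smul] by blast
  qed
  have shift: "proj a (smul (Poly_Mapping.single t c) y) \<in> K.span (F a)"
    if "\<And>a. proj a y \<in> K.span (F a)" for t c y a
  proof -
    let ?D = "Poly_Mapping.keys (components y)"
    have "smul (Poly_Mapping.single t c) y = (\<Sum>d\<in>?D. smul (Poly_Mapping.single t c) (proj d y))"
      by (subst sum_proj[of y, symmetric]) (rule scale_sum_right)
    then have "proj a (smul (Poly_Mapping.single t c) y) = (\<Sum>d\<in>?D. proj a (smul (Poly_Mapping.single t c) (proj d y)))"
      by (simp add: proj_sum)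
    moreover have "proj a (smul (Poly_Mapping.single t c) (proj d y)) \<in> K.span (F a)" for d
      using step[OF that[of d], of t c] proj_homogeneous[OF smul_mem[OF proj_mem[of d y], of t c], of a]
      by (auto simp: K.span_zero)
    ultimately show ?thesis by (simp add: K.span_sum)
  qed
  \<comment> \<open>All degrees are treated at once, since multiplication by a polynomial moves
    components between degrees.\<close>
  have "\<forall>a. proj a x \<in> K.span (F a)" for x
  proof -
    have "x \<in> span S" using S by simp
    then show ?thesis
    proof (induction x rule: span_induct_alt)
      case base
      then show ?case by (simp add: K.span_zero)
    next
      case (step p x y)
      have "proj a x \<in> K.span (F a)" for a
      proof (cases "a \<in> Poly_Mapping.keys (components x)")
        case True
        then have "smul (X_pow (a - a)) (proj a x) \<in> F a" using step(1) unfolding F_def by blast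
        then show ?thesis by (simp add: X_pow_def nat_vec_def zero_vec_def[symmetric] K.span_base)
      next
        case False
        then show ?thesis by (simp add: proj_def in_keys_iff K.span_zero)
      qed
      then have "proj a (smul p x) \<in> K.span (F a)" for a
        by (subst smul_eq_sum) (auto simp: proj_sum intro!: K.span_sum shift)
      then show ?case using step.IH by (simp add: proj_add K.span_add)
    qed
  qed
  then have "M a \<subseteq> K.span (F a)" using proj_homogeneous[of _ a a] by (metis subsetI)
  then show ?thesis using finF by blast
qed

end

subsection \<open>Decomposition vectors and degrees beyond \<open>g\<close>\<close>

lemma lookup_decomposition_vector:
  assumes "finite I"
  shows "Poly_Mapping.lookup (decomposition_vector I Z s) (Y, b) = card {i \<in> I. s i = b \<and> Z i = Y}"
proof -
  have "Poly_Mapping.lookup (decomposition_vector I Z s) (Y, b) = (\<Sum>i\<in>I. if s i = b \<and> Z i = Y then 1 else 0)"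
    unfolding decomposition_vector_def lookup_sum
    by (intro sum.cong) (auto simp: lookup_single when_def)
  then show ?thesis using assms by (simp add: sum.If_cases Int_def)
qed

text \<open>Turns both conditions on \<open>u\<close> into counts of indices: the pairs
  \<open>(s i, Z i)\<close> sort the indices into fibres, and the double sum adds the sizes of the
  fibres over the admissible pairs.\<close>

lemma sum_decomposition_vector:
  fixes Z :: "'i \<Rightarrow> 'n::finite set"
  assumes "finite I" "finite J"
  shows "(\<Sum>b\<in>J. \<Sum>Y | supp (a - b) \<subseteq> Y. Poly_Mapping.lookup (decomposition_vector I Z s) (Y, b)) =
    card {i \<in> I. s i \<in> J \<and> supp (a - s i) \<subseteq> Z i}"
proof -
  let ?S = "{i \<in> I. s i \<in> J \<and> supp (a - s i) \<subseteq> Z i}"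
  let ?T = "Sigma J (\<lambda>b. {Y. supp (a - b) \<subseteq> Y})"
  have "(\<Sum>b\<in>J. \<Sum>Y | supp (a - b) \<subseteq> Y. Poly_Mapping.lookup (decomposition_vector I Z s) (Y, b)) =
      (\<Sum>(b, Y)\<in>?T. card {i \<in> I. s i = b \<and> Z i = Y})"
    by (subst sum.Sigma) (simp_all add: assms lookup_decomposition_vector)
  also have "\<dots> = (\<Sum>t\<in>?T. \<Sum>i | i \<in> ?S \<and> (s i, Z i) = t. 1)"
    by (intro sum.cong) (auto intro!: arg_cong[of _ _ card])
  also have "\<dots> = (\<Sum>i\<in>?S. 1)"
    by (rule sum.group) (use assms in auto)
  finally show ?thesis by simp
qed

text \<open>One index is spent on each unit of the multiplicity of each pair, and the indices are
  then enumerated by natural numbers.\<close>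

lemma exists_decomposition_vector:
  "\<exists>n Z s. u = decomposition_vector {..<n::nat} Z s"
proof -
  let ?D = "Sigma (Poly_Mapping.keys u) (\<lambda>w. {..<Poly_Mapping.lookup u w})"
  have "finite ?D" by simp
  then obtain h where h: "bij_betw h {..<card ?D} ?D"
    using ex_bij_betw_nat_finite atLeast0LessThan by metis
  have single: "(\<Sum>j<k. Poly_Mapping.single w (1::nat)) = Poly_Mapping.single w k" for k w
    by (rule poly_mapping_eqI) (simp add: lookup_sum lookup_single when_def)
  have "(\<Sum>i<card ?D. Poly_Mapping.single (fst (h i)) 1) = (\<Sum>d\<in>?D. Poly_Mapping.single (fst d) (1::nat))"
    by (rule sum.reindex_bij_betw[OF h])
  also have "\<dots> = (\<Sum>w\<in>Poly_Mapping.keys u. \<Sum>j<Poly_Mapping.lookup u w. Poly_Mapping.single w 1)"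
    by (subst sum.Sigma) (auto intro: sum.cong)
  also have "\<dots> = u" unfolding single by (rule sum_single_lookup[symmetric])
  finally have "u = decomposition_vector {..<card ?D} (\<lambda>i. fst (fst (h i))) (\<lambda>i. snd (fst (h i)))"
    by (simp add: decomposition_vector_def)
  then show ?thesis by blast
qed

lemma X_pow_mult: "0 \<le> a \<Longrightarrow> 0 \<le> b \<Longrightarrow> X_pow a * X_pow b = X_pow (a + b)"
proof -
  assume "0 \<le> a" "0 \<le> b"
  then have "nat_vec (a + b) = nat_vec a + nat_vec b"
    by (simp add: nat_vec_def vec_eq_iff less_eq_vec_def nat_add_distrib)
  then show ?thesis by (simp add: X_pow_def mult_single)
qed

lemma X_pow_zero [simp]: "X_pow 0 = 1"
  by (simp add: X_pow_def nat_vec_def zero_vec_def[symmetric])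

text \<open>
  Membership in \<open>Omega g\<close> forces \<open>k \<in> Z i\<close> as soon as \<open>s i $ k = g $ k\<close>; hence no summand appears
  or disappears when a coordinate beyond \<open>g\<close> is increased.
\<close>

lemma active_add_axis:
  assumes Om: "\<forall>i\<in>I. (Z i, s i) \<in> Omega g" and "g $ k \<le> a $ k"
  shows "active I Z s (a + axis k 1) = active I Z s a"
proof -
  have "s i \<le> a + axis k 1 \<and> supp (a + axis k 1 - s i) \<subseteq> Z i \<longleftrightarrow> s i \<le> a \<and> supp (a - s i) \<subseteq> Z i"
    if i: "i \<in> I" for i
  proof -
    have k: "s i $ k \<le> g $ k" and Z: "g $ k = s i $ k \<longrightarrow> k \<in> Z i"
      using Om i by (auto simp: Omega_def less_eq_vec_def)
    have nth: "(a + axis k 1) $ j = (if j = k then a $ k + 1 else a $ j)" for j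
      by (simp add: axis_def)
    have "s i $ j \<le> (a + axis k 1) $ j \<longleftrightarrow> s i $ j \<le> a $ j" for j
      unfolding nth using k assms(2) by (cases "j = k") auto
    then have "s i \<le> a + axis k 1 \<longleftrightarrow> s i \<le> a" by (simp only: less_eq_vec_def)
    moreover have "supp (a + axis k 1 - s i) = insert k (supp (a - s i))"
      using k assms(2) by (auto simp: supp_def vector_minus_component nth simp del: vector_add_component)
    \<comment> \<open>If \<open>k\<close> is not in the support of \<open>a - s i\<close>, then
      \<open>s i $ k\<close>, \<open>g $ k\<close> and \<open>a $ k\<close> coincide, and
      \<open>Omega g\<close> supplies \<open>k\<close>.\<close>
    moreover have "k \<in> Z i" if "supp (a - s i) \<subseteq> Z i"
      using that Z k assms(2) by (cases "a $ k = s i $ k") (auto simp: supp_def)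
    ultimately show ?thesis by (simp only: insert_subset) blast
  qed
  then show ?thesis unfolding active_def by blast
qed

section \<open>Bases in all degrees and the dimension conditions\<close>

context multigraded_module
begin

lemma combination_add_axis:
  assumes "active I Z s (a + axis k 1) = active I Z s a"
  shows "smul (X_var k) (combination I Z s m a c) = combination I Z s m (a + axis k 1) c"
proof -
  have "X_var k * (const_poly (c i) * X_pow (a - s i)) = const_poly (c i) * X_pow (a + axis k 1 - s i)"
    if "i \<in> active I Z s a" for i
  proof -
    have "s i \<le> a" using that by (simp add: active_def)
    moreover have "0 \<le> (axis k 1 :: int ^ 'n)" by (simp add: less_eq_vec_def axis_def)
    ultimately have "X_var k * X_pow (a - s i) = (X_pow (axis k 1 + (a - s i)) :: ('k, 'n) mpol)"
      by (simp add: X_var_def X_pow_mult)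
    moreover have "axis k 1 + (a - s i) = a + axis k 1 - s i" by simp
    ultimately show ?thesis by (metis mult.left_commute)
  qed
  then show ?thesis
    unfolding combination_def assms by (simp add: scale_sum_right)
qed

text \<open>Induction on the total excess of \<open>a\<close> over \<open>g\<close>. Lowering an
  exceeding coordinate \<open>k\<close> by one keeps it at least \<open>g $ k\<close>, so
  multiplication by \<open>X_var k\<close> is bijective from there and carries the basis back up,
  with the same active indices. If \<open>a\<close> has a negative coordinate, both sides are
  trivial, as every \<open>s i\<close> is nonnegative.\<close>

lemma bij_betw_combination_extend:
  assumes Om: "\<forall>i\<in>I. (Z i, s i) \<in> Omega g" and "0 \<le> g" and det: "positively_determined smul M g"
    and base: "\<And>a. a \<in> {0..g} \<Longrightarrow> bij_betw (combination I Z s m a) (coefficients I Z s a) (M a)"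
  shows "bij_betw (combination I Z s m a) (coefficients I Z s a) (M a)"
proof (cases "0 \<le> a")
  case False
  then have "M a = {0}" using det by (simp add: positively_determined_def)
  moreover have act: "active I Z s a = {}"
    using Om False order_trans unfolding active_def Omega_def by blast
  ultimately show ?thesis
    by (auto simp: bij_betw_def combination_def coefficients_def inj_on_def fun_eq_iff)
next
  case True
  then show ?thesis
  proof (induction "\<Sum>j\<in>UNIV. nat (a $ j - g $ j)" arbitrary: a rule: less_induct)
    case less
    show ?case
    proof (cases "a \<le> g")
      case True
      then show ?thesis using less.prems by (intro base) simp
    next
      case False
      then obtain k where k: "g $ k < a $ k" by (auto simp: less_eq_vec_def not_le)
      define b where "b = a - axis k 1"
      have b: "b $ j = (if j = k then a $ k - 1 else a $ j)" for j by (simp add: b_def axis_def)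
      have a: "a = b + axis k 1" by (simp add: b_def)
      have gk: "g $ k \<le> b $ k" using k by (simp add: b)
      have "0 \<le> b" using less.prems \<open>0 \<le> g\<close> k by (auto simp: less_eq_vec_def b dest: spec[of _ k])
      moreover have "(\<Sum>j\<in>UNIV. nat (b $ j - g $ j)) < (\<Sum>j\<in>UNIV. nat (a $ j - g $ j))"
        using k by (intro sum_strict_mono_ex1) (auto simp: b)
      ultimately have "bij_betw (combination I Z s m b) (coefficients I Z s b) (M b)"
        by (rule less.hyps[rotated])
      moreover have "bij_betw (smul (X_var k)) (M b) (M a)"
        using det gk unfolding positively_determined_def a by blast
      ultimately have "bij_betw (smul (X_var k) \<circ> combination I Z s m b) (coefficients I Z s b) (M a)"
        by (rule bij_betw_trans)
      moreover note act = active_add_axis[OF Om gk]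
      have "smul (X_var k) \<circ> combination I Z s m b = combination I Z s m a"
        unfolding a by (rule ext) (simp add: combination_add_axis[OF act])
      moreover have "coefficients I Z s b = coefficients I Z s a"
        unfolding a coefficients_def act ..
      ultimately show ?thesis by simp
    qed
  qed
qed

text \<open>Connects the sum of subspaces in the second condition with the union of images in Rado's
  inequality: passing to the span does not change the dimension. Finiteness of \<open>J\<close>
  matters, since a sum over an infinite set is 0.\<close>

lemma subspace_sum_eq_span:
  assumes "finite J"
  shows "subspace_sum smul M J a = K.span (\<Union>b\<in>J. smul (X_pow (a - b)) ` M b)" (is "?S = K.span ?U")
proof
  show "?S \<subseteq> K.span ?U"
  proof
    fix y assume "y \<in> ?S"
    then obtain x where "\<forall>b\<in>J. x b \<in> M b" and y: "y = (\<Sum>b\<in>J. smul (X_pow (a - b)) (x b))"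
      unfolding subspace_sum_def by blast
    then show "y \<in> K.span ?U" unfolding y by (intro K.span_sum K.span_base) blast
  qed
  have "?U \<subseteq> ?S"
  proof
    fix y assume "y \<in> ?U"
    then obtain b x where b: "b \<in> J" "x \<in> M b" "y = smul (X_pow (a - b)) x" by blast
    let ?x = "\<lambda>b'. if b' = b then x else 0"
    have "y = (\<Sum>b'\<in>J. if b' = b then y else 0)"
      using assms b(1) by simp
    also have "\<dots> = (\<Sum>b'\<in>J. smul (X_pow (a - b')) (?x b'))"
      by (intro sum.cong) (auto simp: b(3))
    finally have "y = (\<Sum>b'\<in>J. smul (X_pow (a - b')) (?x b'))" .
    moreover have "\<forall>b'\<in>J. ?x b' \<in> M b'" using b(2) zero_mem by simp
    ultimately show "y \<in> ?S" unfolding subspace_sum_def by (intro CollectI exI[of _ ?x]) simp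
  qed
  moreover have "K.subspace ?S"
  proof (rule K.subspaceI)
    show "0 \<in> ?S" unfolding subspace_sum_def
      by (intro CollectI exI[of _ "\<lambda>_. 0"]) (simp add: zero_mem)
  next
    fix y z assume "y \<in> ?S" "z \<in> ?S"
    then obtain p q where "y = (\<Sum>b\<in>J. smul (X_pow (a - b)) (p b))" "\<forall>b\<in>J. p b \<in> M b"
      "z = (\<Sum>b\<in>J. smul (X_pow (a - b)) (q b))" "\<forall>b\<in>J. q b \<in> M b"
      unfolding subspace_sum_def by blast
    then show "y + z \<in> ?S" unfolding subspace_sum_def
      by (intro CollectI exI[of _ "\<lambda>b. p b + q b"]) (simp add: scale_right_distrib sum.distrib add_mem)
  next
    fix c y assume "y \<in> ?S"
    then obtain p where p: "y = (\<Sum>b\<in>J. smul (X_pow (a - b)) (p b))" "\<forall>b\<in>J. p b \<in> M b"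
      unfolding subspace_sum_def by blast
    have "smul (const_poly c) y = (\<Sum>b\<in>J. smul (X_pow (a - b)) (smul (const_poly c) (p b)))"
      by (simp add: p(1) scale_sum_right mult.commute)
    then show "smul (const_poly c) y \<in> ?S" unfolding subspace_sum_def
      using p(2) by (intro CollectI exI[of _ "\<lambda>b. smul (const_poly c) (p b)"]) (simp add: smul_const_mem)
  qed
  ultimately show "K.span ?U \<subseteq> ?S" by (rule K.span_minimal)
qed

lemma combination_basis_iff:
  assumes "finite I"
  shows "bij_betw (combination I Z s m a) (coefficients I Z s a) (M a) \<longleftrightarrow>
    inj_on (\<lambda>i. smul (X_pow (a - s i)) (m i)) (active I Z s a) \<and>
    K.independent ((\<lambda>i. smul (X_pow (a - s i)) (m i)) ` active I Z s a) \<and>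
    K.span ((\<lambda>i. smul (X_pow (a - s i)) (m i)) ` active I Z s a) = M a"
  unfolding combination_def[abs_def] coefficients_def
  by (rule K.bij_betw_combinations_iff[OF finite_active[OF assms]])

lemma dimension_conditions_if_stanley:
  fixes Z :: "'i \<Rightarrow> 'n set"
  assumes stanley: "stanley_decomposition smul M I Z m"
    and deg: "\<forall>i\<in>I. s i = hdeg M (m i) \<and> 0 \<le> s i" and "finite J" "J \<subseteq> {0..a}"
  shows "card {i \<in> I. s i \<in> {0..a} \<and> supp (a - s i) \<subseteq> Z i} = K.dim (M a)"
    and "card {i \<in> I. s i \<in> J \<and> supp (a - s i) \<subseteq> Z i} \<le> K.dim (subspace_sum smul M J a)"
proof -
  let ?v = "\<lambda>i. smul (X_pow (a - s i)) (m i)"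
  have "finite I" using stanley by (simp add: stanley_decomposition_def)
  have m: "\<forall>i\<in>I. m i \<in> M (s i)"
  proof
    fix i assume i: "i \<in> I"
    then obtain b where b: "m i \<in> M b" using stanley by (auto simp: stanley_decomposition_def)
    have "polys_in (Z i) \<inter> {p. smul p (m i) = 0} = {0}"
      using stanley i by (simp add: stanley_decomposition_def)
    moreover have "1 \<in> (polys_in (Z i) :: ('k, 'n) mpol set)" by (simp add: polys_in_def)
    ultimately have "smul 1 (m i) \<noteq> 0" by auto
    then have "hdeg M (m i) = b" using b by (intro hdeg_eq) auto
    then show "m i \<in> M (s i)" using deg i b by simp
  qed
  have basis: "inj_on ?v (active I Z s a)" "K.independent (?v ` active I Z s a)" "K.span (?v ` active I Z s a) = M a"
    using bij_betw_gen_map_if_stanley[OF stanley] combination_basis_iff[OF \<open>finite I\<close>, of Z s m a]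
    unfolding bij_betw_gen_map_iff[OF \<open>finite I\<close> m] by blast+
  have "K.dim (M a) = card (active I Z s a)"
    using K.dim_span_eq_card_independent[OF basis(2)] basis by (simp add: card_image)
  moreover have "{i \<in> I. s i \<in> {0..a} \<and> supp (a - s i) \<subseteq> Z i} = active I Z s a"
    using deg by (auto simp: active_def)
  ultimately show "card {i \<in> I. s i \<in> {0..a} \<and> supp (a - s i) \<subseteq> Z i} = K.dim (M a)" by simp
  let ?S = "{i \<in> I. s i \<in> J \<and> supp (a - s i) \<subseteq> Z i}"
  let ?U = "\<Union>b\<in>J. smul (X_pow (a - b)) ` M b"
  have S: "?S \<subseteq> active I Z s a" using assms(4) by (auto simp: active_def)
  have "card ?S = card (?v ` ?S)"
    using inj_on_subset[OF basis(1) S] by (simp add: card_image)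
  also have "\<dots> = K.dim (?v ` ?S)"
    using K.independent_mono[OF basis(2) image_mono[OF S]] by (rule K.dim_eq_card_independent[symmetric])
  also have "\<dots> \<le> K.dim ?U"
  proof (rule K.dim_mono_finite_span)
    \<comment> \<open>The basis of \<open>M a\<close> itself is the finite set that bounds the
      dimensions.\<close>
    show "finite (?v ` active I Z s a)" using \<open>finite I\<close> by (simp add: finite_active)
    show "?U \<subseteq> K.span (?v ` active I Z s a)"
      using assms(4) by (auto simp: basis(3) intro!: smul_X_pow_mem)
    have "?v ` ?S \<subseteq> ?U" using m by blast
    then show "?v ` ?S \<subseteq> K.span ?U" using K.span_superset by (rule subset_trans)
  qed
  finally show "card ?S \<le> K.dim (subspace_sum smul M J a)"
    by (simp add: subspace_sum_eq_span[OF \<open>finite J\<close>])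
qed

lemma stanley_if_dimension_conditions:
  fixes Z :: "'i \<Rightarrow> 'n set"
  assumes inf: "infinite (UNIV :: 'k set)" and fg: "finitely_generated smul"
    and "0 \<le> g" and det: "positively_determined smul M g"
    and "finite I" and Om: "\<forall>i\<in>I. (Z i, s i) \<in> Omega g"
    and dim: "\<And>a. a \<in> {0..g} \<Longrightarrow> card {i \<in> I. s i \<in> {0..a} \<and> supp (a - s i) \<subseteq> Z i} = K.dim (M a)"
    and rado: "\<And>a J. a \<in> {0..g} \<Longrightarrow> J \<subseteq> {0..a} \<Longrightarrow>
      card {i \<in> I. s i \<in> J \<and> supp (a - s i) \<subseteq> Z i} \<le> K.dim (subspace_sum smul M J a)"
  shows "\<exists>m. hilbert_decomposition smul M I Z s \<and> stanley_decomposition smul M I Z m \<and>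
    (\<forall>i\<in>I. hdeg M (m i) = s i)"
proof -
  have s: "0 \<le> s i" "s i \<le> g" if "i \<in> I" for i using Om that by (auto simp: Omega_def)
  obtain F where F: "\<And>a. finite (F a)" "\<And>a. M a \<subseteq> K.span (F a)"
    using finite_dimensional_component[OF fg] by metis
  have active: "active I Z s a = {i \<in> I. s i \<in> {0..a} \<and> supp (a - s i) \<subseteq> Z i}" for a
    using s by (auto simp: active_def)
  have "\<exists>w. (\<forall>i\<in>I. w i \<in> M (s i)) \<and> (\<forall>a\<in>{0..g}.
      inj_on (\<lambda>i. smul (X_pow (a - s i)) (w i)) (active I Z s a) \<and>
      K.independent ((\<lambda>i. smul (X_pow (a - s i)) (w i)) ` active I Z s a))"
  proof (rule K.generic_independent_transversal[OF inf \<open>finite I\<close>, where F = F and f = "\<lambda>a i. smul (X_pow (a - s i))"])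
    show "finite {0..g}" by (rule finite_int_vec_interval)
    show "K.subspace (M (s i))" for i by (rule subspace_M)
    show "active I Z s a \<subseteq> I" for a by (auto simp: active_def)
    show "module_hom (\<lambda>c. smul (const_poly c)) (\<lambda>c. smul (const_poly c)) (smul (X_pow (a - s i)))" for a i
      by (rule module_hom_smul)
    show "finite (F a)" for a by (rule F)
    show "smul (X_pow (a - s i)) ` M (s i) \<subseteq> K.span (F a)" if "i \<in> active I Z s a" for a i
      using that smul_X_pow_mem F(2)[of a] by (auto simp: active_def)
    fix a S assume a: "a \<in> {0..g}" and S: "S \<subseteq> active I Z s a"
    have sS: "s ` S \<subseteq> {0..a}" using S by (auto simp: active)
    \<comment> \<open>\<open>S\<close> is enlarged to all active indices whose degrees occur in
      \<open>S\<close>. The spaces on the right depend on these degrees only, so they stay the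
      same.\<close>
    have "card S \<le> card {i \<in> I. s i \<in> s ` S \<and> supp (a - s i) \<subseteq> Z i}"
      using S \<open>finite I\<close> by (intro card_mono) (auto simp: active_def)
    also have "\<dots> \<le> K.dim (subspace_sum smul M (s ` S) a)" by (rule rado[OF a sS])
    also have "\<dots> = K.dim (\<Union>b\<in>s ` S. smul (X_pow (a - b)) ` M b)"
      by (simp only: subspace_sum_eq_span[OF finite_subset[OF sS finite_int_vec_interval]] K.dim_span)
    finally show "card S \<le> K.dim (\<Union>i\<in>S. smul (X_pow (a - s i)) ` M (s i))" by simp
  qed
  then obtain m where m: "\<forall>i\<in>I. m i \<in> M (s i)"
    and inj: "\<And>a. a \<in> {0..g} \<Longrightarrow> inj_on (\<lambda>i. smul (X_pow (a - s i)) (m i)) (active I Z s a)"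
    and ind: "\<And>a. a \<in> {0..g} \<Longrightarrow> K.independent ((\<lambda>i. smul (X_pow (a - s i)) (m i)) ` active I Z s a)"
    by blast
  have "bij_betw (combination I Z s m a) (coefficients I Z s a) (M a)" if a: "a \<in> {0..g}" for a
    unfolding combination_basis_iff[OF \<open>finite I\<close>]
  proof (intro conjI inj ind a K.span_eq_if_card_eq_dim[OF F subspace_M])
    show "(\<lambda>i. smul (X_pow (a - s i)) (m i)) ` active I Z s a \<subseteq> M a"
      using m smul_X_pow_mem by (auto simp: active_def)
    show "card ((\<lambda>i. smul (X_pow (a - s i)) (m i)) ` active I Z s a) = K.dim (M a)"
      using dim[OF a] card_image[OF inj[OF a]] by (simp only: active)
  qed
  then have "\<forall>a. bij_betw (combination I Z s m a) (coefficients I Z s a) (M a)"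
    using bij_betw_combination_extend[OF Om \<open>0 \<le> g\<close> det] by blast
  then have bij: "bij_betw (gen_map I m) (ext_sum I Z) UNIV"
    by (simp add: bij_betw_gen_map_iff[OF \<open>finite I\<close> m])
  moreover have "hdeg M (m i) = s i" if i: "i \<in> I" for i
  proof (rule hdeg_eq)
    show "m i \<in> M (s i)" using m i by blast
    \<comment> \<open>In its own degree \<open>s i\<close> the index \<open>i\<close> is active and
      contributes \<open>m i\<close> itself; independence there excludes 0, as
      \<open>hdeg_eq\<close> requires.\<close>
    have "i \<in> active I Z s (s i)" using i by (simp add: active_def supp_def)
    then have "smul (X_pow (s i - s i)) (m i) \<in> (\<lambda>j. smul (X_pow (s i - s j)) (m j)) ` active I Z s (s i)"
      by (rule imageI)
    moreover have "0 \<notin> (\<lambda>j. smul (X_pow (s i - s j)) (m j)) ` active I Z s (s i)"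
      using ind[of "s i"] s[OF i] K.dependent_zero by (meson atLeastAtMost_iff)
    ultimately have "smul (X_pow (s i - s i)) (m i) \<noteq> 0" by metis
    then show "m i \<noteq> 0" by auto
  qed
  ultimately show ?thesis
    using hilbert_decomposition_gen_map[OF \<open>finite I\<close> m bij] stanley_if_bij_betw_gen_map[OF \<open>finite I\<close> m bij]
    by blast
qed

end

theorem theorem5p5:
  fixes smul :: "('k::field, 'n::finite) mpol \<Rightarrow> 'm::ab_group_add \<Rightarrow> 'm"
    and M :: "int ^ 'n \<Rightarrow> 'm set"
    and g :: "int ^ 'n"
    and u :: "('n set \<times> (int ^ 'n)) \<Rightarrow>\<^sub>0 nat"
  assumes "infinite (UNIV :: 'k set)"
    and "multigraded_module smul M"
    and "finitely_generated smul"
    and "0 \<le> g"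
    and "positively_determined smul M g"
    and "u \<in> free_comm_monoid (Omega g)"
  shows
    "(\<exists>(I :: nat set) Z s.
        hilbert_decomposition smul M I Z s \<and> determined g I s \<and>
        u = decomposition_vector I Z s \<and>
        (\<exists>m. stanley_decomposition smul M I Z m \<and> determined g I (\<lambda>i. hdeg M (m i)) \<and>
             (\<forall>i \<in> I. s i = hdeg M (m i))))
     \<longleftrightarrow>
     (\<forall>a \<in> {0..g}.
        (\<Sum>b \<in> {0..a}. \<Sum>Z | supp (a - b) \<subseteq> Z. Poly_Mapping.lookup u (Z, b))
          = dim_K smul (M a)) \<and>
     (\<forall>a \<in> {0..g}. \<forall>J \<subseteq> {0..a}.
        (\<Sum>b \<in> J. \<Sum>Z | supp (a - b) \<subseteq> Z. Poly_Mapping.lookup u (Z, b))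
          \<le> dim_K smul (subspace_sum smul M J a))"
    (is "?L \<longleftrightarrow> ?R")
proof -
  interpret multigraded_module smul M by fact
  have Om: "\<forall>i\<in>I. (Z i, s i) \<in> Omega g" if "finite I" "u = decomposition_vector I Z s" for I :: "nat set" and Z s
  proof
    fix i assume "i \<in> I"
    \<comment> \<open>The index \<open>i\<close> is itself counted, so \<open>u\<close> is positive
      at its pair, which therefore lies in the support of \<open>u\<close>.\<close>
    then have "card {j \<in> I. s j = s i \<and> Z j = Z i} \<noteq> 0" using that(1) by auto
    then have "(Z i, s i) \<in> Poly_Mapping.keys u"
      by (simp add: that in_keys_iff lookup_decomposition_vector)
    then show "(Z i, s i) \<in> Omega g" using assms(6) unfolding free_comm_monoid_def by blast
  qed
  have finJ: "finite J" if "J \<subseteq> {0..a}" for J and a :: "int ^ 'n"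
    using that finite_int_vec_interval by (rule finite_subset)
  show ?thesis
  proof
    assume ?L
    then obtain I :: "nat set" and Z s m where u: "u = decomposition_vector I Z s"
      and stanley: "stanley_decomposition smul M I Z m" and deg: "\<forall>i \<in> I. s i = hdeg M (m i)"
      by blast
    have "finite I" using stanley by (simp add: stanley_decomposition_def)
    have deg': "\<forall>i\<in>I. s i = hdeg M (m i) \<and> 0 \<le> s i"
      using deg Om[OF \<open>finite I\<close> u] by (auto simp: Omega_def)
    note conds = dimension_conditions_if_stanley[OF stanley deg']
    show ?R unfolding u
    proof (intro conjI ballI allI impI)
      fix a :: "int ^ 'n"
      show "(\<Sum>b \<in> {0..a}. \<Sum>Y | supp (a - b) \<subseteq> Y. Poly_Mapping.lookup (decomposition_vector I Z s) (Y, b)) = dim_K smul (M a)"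
        unfolding sum_decomposition_vector[OF \<open>finite I\<close> finite_int_vec_interval] dim_K_def
        by (rule conds(1)[of "{}"]) auto
    next
      fix a :: "int ^ 'n" and J assume J: "J \<subseteq> {0..a}"
      show "(\<Sum>b \<in> J. \<Sum>Y | supp (a - b) \<subseteq> Y. Poly_Mapping.lookup (decomposition_vector I Z s) (Y, b))
          \<le> dim_K smul (subspace_sum smul M J a)"
        unfolding sum_decomposition_vector[OF \<open>finite I\<close> finJ[OF J]] dim_K_def
        by (rule conds(2)[OF finJ[OF J] J])
    qed
  next
    assume R: ?R
    obtain n Z s where u: "u = decomposition_vector {..<n::nat} Z s"
      using exists_decomposition_vector by blast
    have OmI: "\<forall>i\<in>{..<n}. (Z i, s i) \<in> Omega g" by (rule Om[OF _ u]) simp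
    have "\<exists>m. hilbert_decomposition smul M {..<n} Z s \<and> stanley_decomposition smul M {..<n} Z m \<and>
      (\<forall>i\<in>{..<n}. hdeg M (m i) = s i)"
    proof (rule stanley_if_dimension_conditions[OF assms(1,3-5) finite_lessThan OmI])
      fix a assume a: "a \<in> {0..g}"
      from R have "\<forall>a \<in> {0..g}. (\<Sum>b \<in> {0..a}. \<Sum>Z | supp (a - b) \<subseteq> Z. Poly_Mapping.lookup u (Z, b))
        = dim_K smul (M a)" by (rule conjunct1)
      from bspec[OF this a] show "card {i \<in> {..<n}. s i \<in> {0..a} \<and> supp (a - s i) \<subseteq> Z i} = K.dim (M a)"
        unfolding u sum_decomposition_vector[OF finite_lessThan finite_int_vec_interval] dim_K_def .
    next
      fix a J assume a: "a \<in> {0..g}" and J: "J \<subseteq> {0..a}"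
      from R have "\<forall>a \<in> {0..g}. \<forall>J \<subseteq> {0..a}.
        (\<Sum>b \<in> J. \<Sum>Z | supp (a - b) \<subseteq> Z. Poly_Mapping.lookup u (Z, b))
          \<le> dim_K smul (subspace_sum smul M J a)" by (rule conjunct2)
      from bspec[OF this a, rule_format, OF J]
      show "card {i \<in> {..<n}. s i \<in> J \<and> supp (a - s i) \<subseteq> Z i} \<le> K.dim (subspace_sum smul M J a)"
        unfolding u sum_decomposition_vector[OF finite_lessThan finJ[OF J]] dim_K_def .
    qed
    then obtain m where m: "hilbert_decomposition smul M {..<n} Z s" "stanley_decomposition smul M {..<n} Z m"
      "\<forall>i\<in>{..<n}. hdeg M (m i) = s i" by blast
    have "determined g {..<n} s" using OmI by (auto simp: determined_def Omega_def)
    moreover have "determined g {..<n} (\<lambda>i. hdeg M (m i))"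
      using calculation m(3) by (simp add: determined_def)
    moreover have "\<forall>i\<in>{..<n}. s i = hdeg M (m i)" using m(3) by simp
    ultimately show ?L using m(1,2) u by iprover
  qed
qed

end
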